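(* Let $M$ be a compact smooth Riemannian manifold with $\dim(M)\ge 1$. Let $S(M)$ denote either $C^0(M)$ (when $\dim(M)\ge1$) or $\mathcal H(M)$ (when $\dim(M)\ge2$). Then there exists a residual subset $\mathcal R\subset S(M)$ such that for every $f\in\mathcal R$ and every non-trivial weight $\vartheta\in\ell^\infty(\mathbb N)$, \[ h_{\mathrm{top}}\bigl(f,\mathcal N_\vartheta(f,M)\bigr)=h_{\mathrm{top}}(f,M)=\infty . \] In particular, every $f\in\mathcal R$ is Bohr chaotic.
   Context: $C^0(M)$ is the space of continuous self-maps of $M$ with the metric $d_{C^0}(g_1,g_2)=\max_{x\in M}d(g_1(x),g_2(x))$. $\mathcal H(M)$ is the space of homeomorphisms of $M$ with the metric $d_{\mathcal H}(g_1,g_2)=\max\{d_{C^0}(g_1,g_2),d_{C^0}(g_1^{-1},g_2^{-1})\}$. A subset of a Baire space is residual if it contains a dense $G_\delta$ subset. A bounded real sequence $\vartheta=(\vartheta_n)_{n\ge 0}$ is a non-trivial weight if $\limsup_{N\to\infty}\frac1N\sum_{n=0}^{N-1}|\vartheta_n|>0$. For a compact metric space $(X,d)$ and continuous $f:X\to X$, $\mathcal N_\vartheta(f,X)$ is the set of $x\in X$ for which there is a continuous $\varphi:X\to\mathbb R$ with $\limsup_{N\to\infty}\frac1N\left|\sum_{n=0}^{N-1}\vartheta_n\varphi(f^nx)\right|>0$. $(X,f)$ is Bohr chaotic if $\mathcal N_\vartheta(f,X)\neq\emptyset$ for every non-trivial weight $\vartheta$. Bowen topological entropy of a subset $E\subset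 X$: let $B_u(f;x,r)=\{z\in X: d(f^ix,f^iz)<r,\ 0\le i\le u-1\}$. For $t\ge0$ let $C(E;t,n,r,f)$ be the infimum of $\sum e^{-tu}$ over all finite or countable covers of $E$ by sets $B_u(f;x,r)$ with $u\ge n$; let $C(E;t,r,f)=\lim_{n\to\infty}C(E;t,n,r,f)$, $h_{\mathrm{top}}(E;r,f)=\inf\{t:C(E;t,r,f)=0\}$ and $h_{\mathrm{top}}(f,E)=\lim_{r\to0}h_{\mathrm{top}}(E;r,f)$. For compact invariant $E$ this equals the classical topological entropy. *)

theory Defs
  imports "HOL-Analysis.Analysis"
begin

section \<open>Smooth Riemannian manifolds\<close>

text \<open>
  For open \<open>S\<close>, \<open>Ck_on k S f\<close> is the usual \<open>C\<^sup>k\<close>: all iterated directional derivatives of order at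
  most \<open>k\<close> exist and are continuous (continuity of the directional derivatives gives continuity of
  the total derivative because the domain is finite-dimensional).
\<close>

primrec Ck_on ::
    "nat \<Rightarrow> 'e::euclidean_space set \<Rightarrow> ('e \<Rightarrow> 'b::real_normed_vector) \<Rightarrow> bool" where
  "Ck_on 0 S f \<longleftrightarrow> continuous_on S f"
| "Ck_on (Suc k) S f \<longleftrightarrow>
     (\<forall>x\<in>S. f differentiable (at x)) \<and> (\<forall>v. Ck_on k S (\<lambda>x. frechet_derivative f (at x) v))"

definition smooth_on :: "'e::euclidean_space set \<Rightarrow> ('e \<Rightarrow> 'b::real_normed_vector) \<Rightarrow> bool" where
  "smooth_on S f \<longleftrightarrow> (\<forall>k. Ck_on k S f)"

text \<open>
  A manifold is the whole type \<open>'m\<close>, with the topology of its metric; the model space is \<open>'e\<close>, so its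
  dimension is \<open>DIM('e)\<close>. A chart is a pair \<open>(U, \<phi>)\<close>; the values of \<open>\<phi>\<close> outside \<open>U\<close> are irrelevant.
\<close>

type_synonym ('m, 'e) chart = "'m set \<times> ('m \<Rightarrow> 'e)"

definition is_chart :: "('m::topological_space, 'e::euclidean_space) chart \<Rightarrow> bool" where
  "is_chart c \<longleftrightarrow> open (fst c) \<and> open (snd c ` fst c) \<and>
     homeomorphism (fst c) (snd c ` fst c) (snd c) (inv_into (fst c) (snd c))"

definition transition :: "('m, 'e) chart \<Rightarrow> ('m, 'e) chart \<Rightarrow> 'e \<Rightarrow> 'e" where
  "transition c c' = snd c' \<circ> inv_into (fst c) (snd c)"

definition smooth_atlas :: "('m::topological_space, 'e::euclidean_space) chart set \<Rightarrow> bool" where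
  "smooth_atlas A \<longleftrightarrow> (\<forall>c\<in>A. is_chart c) \<and> (\<Union>c\<in>A. fst c) = UNIV \<and>
     (\<forall>c\<in>A. \<forall>c'\<in>A. smooth_on (snd c ` (fst c \<inter> fst c')) (transition c c'))"

text \<open>
  A Riemannian metric is given by its coordinate expressions: \<open>G c y\<close> is the inner product at the
  point with coordinates \<open>y\<close> in the chart \<open>c\<close>. The last clause is the transformation rule of a
  covariant 2-tensor.
\<close>

definition riemannian_metric ::
    "('m, 'e::euclidean_space) chart set \<Rightarrow> (('m, 'e) chart \<Rightarrow> 'e \<Rightarrow> 'e \<Rightarrow> 'e \<Rightarrow> real) \<Rightarrow> bool" where
  "riemannian_metric A G \<longleftrightarrow>
     (\<forall>c\<in>A. \<forall>y\<in>snd c ` fst c.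
        bilinear (G c y) \<and> (\<forall>v w. G c y v w = G c y w v) \<and> (\<forall>v. v \<noteq> 0 \<longrightarrow> G c y v v > 0)) \<and>
     (\<forall>c\<in>A. \<forall>v w. smooth_on (snd c ` fst c) (\<lambda>y. G c y v w)) \<and>
     (\<forall>c\<in>A. \<forall>c'\<in>A. \<forall>p\<in>fst c \<inter> fst c'. \<forall>v w.
        G c (snd c p) v w =
        G c' (snd c' p) (frechet_derivative (transition c c') (at (snd c p)) v)
                        (frechet_derivative (transition c c') (at (snd c p)) w))"

definition C1_curve_on ::
    "('m::topological_space, 'e::euclidean_space) chart set \<Rightarrow> real \<Rightarrow> real \<Rightarrow> (real \<Rightarrow> 'm) \<Rightarrow> bool" where
  "C1_curve_on A a b \<gamma> \<longleftrightarrow> continuous_on {a..b} \<gamma> \<and>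
     (\<forall>c\<in>A. \<exists>D. continuous_on ({a..b} \<inter> \<gamma> -` fst c) D \<and>
        (\<forall>t\<in>{a..b} \<inter> \<gamma> -` fst c. (snd c \<circ> \<gamma> has_vector_derivative D t) (at t within {a..b})))"

definition piecewise_C1_curve ::
    "('m::topological_space, 'e::euclidean_space) chart set \<Rightarrow> (real \<Rightarrow> 'm) \<Rightarrow> bool" where
  "piecewise_C1_curve A \<gamma> \<longleftrightarrow> (\<exists>S. finite S \<and> {0, 1} \<subseteq> S \<and> S \<subseteq> {0..1} \<and>
     (\<forall>a\<in>S. \<forall>b\<in>S. a < b \<and> {a<..<b} \<inter> S = {} \<longrightarrow> C1_curve_on A a b \<gamma>))"

text \<open>
  The speed does not depend on the chart that is chosen around \<open>\<gamma> t\<close>, by the transformation rule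
  for \<open>G\<close>. Its values at the finitely many break points do not affect the length.
\<close>

definition speed ::
    "('m, 'e::euclidean_space) chart set \<Rightarrow> (('m, 'e) chart \<Rightarrow> 'e \<Rightarrow> 'e \<Rightarrow> 'e \<Rightarrow> real) \<Rightarrow>
     (real \<Rightarrow> 'm) \<Rightarrow> real \<Rightarrow> real" where
  "speed A G \<gamma> t =
     (let c = (SOME c. c \<in> A \<and> \<gamma> t \<in> fst c);
          v = vector_derivative (snd c \<circ> \<gamma>) (at t)
      in sqrt (G c (snd c (\<gamma> t)) v v))"

definition curve_length ::
    "('m, 'e::euclidean_space) chart set \<Rightarrow> (('m, 'e) chart \<Rightarrow> 'e \<Rightarrow> 'e \<Rightarrow> 'e \<Rightarrow> real) \<Rightarrow>
     (real \<Rightarrow> 'm) \<Rightarrow> ennreal" where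
  "curve_length A G \<gamma> = (\<integral>\<^sup>+t\<in>{0..1}. ennreal (speed A G \<gamma> t) \<partial>lborel)"

definition riemannian_dist ::
    "('m::topological_space, 'e::euclidean_space) chart set \<Rightarrow>
     (('m, 'e) chart \<Rightarrow> 'e \<Rightarrow> 'e \<Rightarrow> 'e \<Rightarrow> real) \<Rightarrow> 'm \<Rightarrow> 'm \<Rightarrow> ennreal" where
  "riemannian_dist A G p q =
     (INF \<gamma>\<in>{\<gamma>. piecewise_C1_curve A \<gamma> \<and> \<gamma> 0 = p \<and> \<gamma> 1 = q}. curve_length A G \<gamma>)"

text \<open>
  The metric of the type is the Riemannian distance. Connectedness is not required; the Riemannian
  distance between different components is infinite, so there the metric is only required to be
  compatible with the topology of the manifold, which is part of the notion of a chart.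
\<close>

definition riemannian_manifold ::
    "('m::metric_space, 'e::euclidean_space) chart set \<Rightarrow>
     (('m, 'e) chart \<Rightarrow> 'e \<Rightarrow> 'e \<Rightarrow> 'e \<Rightarrow> real) \<Rightarrow> bool" where
  "riemannian_manifold A G \<longleftrightarrow> smooth_atlas A \<and> riemannian_metric A G \<and>
     (\<forall>p q. connected_component UNIV p q \<longrightarrow> ennreal (dist p q) = riemannian_dist A G p q)"

section \<open>Spaces of maps\<close>

text \<open>These suprema are attained maxima when the space is compact and the maps are continuous.\<close>

definition dist_C0 :: "('m::metric_space \<Rightarrow> 'm) \<Rightarrow> ('m \<Rightarrow> 'm) \<Rightarrow> real" where
  "dist_C0 f g = (SUP x. dist (f x) (g x))"

definition dist_homeo :: "('m::metric_space \<Rightarrow> 'm) \<Rightarrow> ('m \<Rightarrow> 'm) \<Rightarrow> real" where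
  "dist_homeo f g = max (dist_C0 f g) (dist_C0 (inv f) (inv g))"

definition C0_maps :: "('m::metric_space \<Rightarrow> 'm) set" where
  "C0_maps = {f. continuous_on UNIV f}"

definition homeos :: "('m::metric_space \<Rightarrow> 'm) set" where
  "homeos = {f. homeomorphism UNIV UNIV f (inv f)}"

definition C0_space :: "('m::metric_space \<Rightarrow> 'm) topology" where
  "C0_space = Metric_space.mtopology C0_maps dist_C0"

definition homeo_space :: "('m::metric_space \<Rightarrow> 'm) topology" where
  "homeo_space = Metric_space.mtopology homeos dist_homeo"

definition residual_in :: "'a topology \<Rightarrow> 'a set \<Rightarrow> bool" where
  "residual_in X R \<longleftrightarrow> R \<subseteq> topspace X \<and>
     (\<exists>D. gdelta_in X D \<and> X closure_of D = topspace X \<and> D \<subseteq> R)"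

lemma bdd_above_dist:
  fixes f g :: "'m::metric_space \<Rightarrow> 'm"
  assumes "compact (UNIV :: 'm set)"
  shows "bdd_above (range (\<lambda>x. dist (f x) (g x)))"
proof -
  obtain e where "\<And>x y :: 'm. dist x y \<le> e"
    using compact_imp_bounded[OF assms] unfolding bounded_two_points by auto
  then show ?thesis by (intro bdd_aboveI) auto
qed

lemma dist_C0_upper:
  fixes f g :: "'m::metric_space \<Rightarrow> 'm"
  assumes "compact (UNIV :: 'm set)"
  shows "dist (f x) (g x) \<le> dist_C0 f g"
  unfolding dist_C0_def by (rule cSUP_upper[OF UNIV_I bdd_above_dist[OF assms]])

lemma Metric_space_dist_C0:
  assumes "compact (UNIV :: 'm::metric_space set)"
  shows "Metric_space (S :: ('m \<Rightarrow> 'm) set) dist_C0"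
proof
  fix f g h :: "'m \<Rightarrow> 'm"
  note up = dist_C0_upper[OF assms]
  show "0 \<le> dist_C0 f g" by (rule order_trans[OF zero_le_dist up[of f undefined g]])
  show "dist_C0 f g = dist_C0 g f" by (simp add: dist_C0_def dist_commute)
  show "dist_C0 f g = 0 \<longleftrightarrow> f = g"
  proof
    assume "dist_C0 f g = 0"
    then have "dist (f x) (g x) \<le> 0" for x using up[of f x g] by simp
    then show "f = g" by (intro ext) simp
  qed (simp add: dist_C0_def)
  show "dist_C0 f h \<le> dist_C0 f g + dist_C0 g h"
    unfolding dist_C0_def[of f h]
  proof (rule cSUP_least)
    fix x
    show "dist (f x) (h x) \<le> dist_C0 f g + dist_C0 g h"
      using dist_triangle[of "f x" "h x" "g x"] up[of f x g] up[of g x h] by linarith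
  qed simp
qed

lemma Metric_space_dist_homeo:
  assumes "compact (UNIV :: 'm::metric_space set)"
  shows "Metric_space (homeos :: ('m \<Rightarrow> 'm) set) dist_homeo"
proof -
  interpret C: Metric_space "UNIV :: ('m \<Rightarrow> 'm) set" dist_C0
    by (rule Metric_space_dist_C0[OF assms])
  show ?thesis
  proof
    fix f g h :: "'m \<Rightarrow> 'm"
    show "0 \<le> dist_homeo f g" by (simp add: dist_homeo_def max_def)
    show "dist_homeo f g = dist_homeo g f" by (simp add: dist_homeo_def C.commute)
    have "dist_C0 f g \<le> dist_homeo f g" "0 \<le> dist_C0 f g" by (simp_all add: dist_homeo_def)
    then have "f = g" if "dist_homeo f g = 0"
      using that C.zero[of f g] by simp
    moreover have "dist_homeo f f = 0" by (simp add: dist_homeo_def)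
    ultimately show "dist_homeo f g = 0 \<longleftrightarrow> f = g" by blast
    show "dist_homeo f h \<le> dist_homeo f g + dist_homeo g h"
      using C.triangle[of f g h] C.triangle[of "inv f" "inv g" "inv h"]
      by (simp add: dist_homeo_def max_def)
  qed
qed

section \<open>Weights and Bohr chaos\<close>

definition nontrivial_weight :: "(nat \<Rightarrow> real) \<Rightarrow> bool" where
  "nontrivial_weight \<theta> \<longleftrightarrow> bounded (range \<theta>) \<and>
     limsup (\<lambda>N. ereal ((1 / real N) * (\<Sum>n<N. \<bar>\<theta> n\<bar>))) > 0"

definition non_orthogonal :: "(nat \<Rightarrow> real) \<Rightarrow> ('m::metric_space \<Rightarrow> 'm) \<Rightarrow> 'm set" where
  "non_orthogonal \<theta> f = {x. \<exists>\<phi> :: 'm \<Rightarrow> real. continuous_on UNIV \<phi> \<and>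
     limsup (\<lambda>N. ereal ((1 / real N) * \<bar>\<Sum>n<N. \<theta> n * \<phi> ((f ^^ n) x)\<bar>)) > 0}"

definition bohr_chaotic :: "('m::metric_space \<Rightarrow> 'm) \<Rightarrow> bool" where
  "bohr_chaotic f \<longleftrightarrow> (\<forall>\<theta>. nontrivial_weight \<theta> \<longrightarrow> non_orthogonal \<theta> f \<noteq> {})"

section \<open>Bowen topological entropy of subsets\<close>

definition bowen_ball :: "('m::metric_space \<Rightarrow> 'm) \<Rightarrow> nat \<Rightarrow> 'm \<Rightarrow> real \<Rightarrow> 'm set" where
  "bowen_ball f u x r = {z. \<forall>i<u. dist ((f ^^ i) x) ((f ^^ i) z) < r}"

text \<open>A cover by Bowen balls is indexed by the set \<open>K\<close> of pairs (centre, order).\<close>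

definition bowen_covers ::
    "'m::metric_space set \<Rightarrow> nat \<Rightarrow> real \<Rightarrow> ('m \<Rightarrow> 'm) \<Rightarrow> ('m \<times> nat) set set" where
  "bowen_covers E n r f = {K. countable K \<and> (\<forall>(x, u)\<in>K. u \<ge> n) \<and>
     E \<subseteq> (\<Union>(x, u)\<in>K. bowen_ball f u x r)}"

definition bowen_pre ::
    "'m::metric_space set \<Rightarrow> real \<Rightarrow> nat \<Rightarrow> real \<Rightarrow> ('m \<Rightarrow> 'm) \<Rightarrow> ennreal" where
  "bowen_pre E t n r f =
     (INF K\<in>bowen_covers E n r f. \<Sum>\<^sub>\<infinity>(x, u)\<in>K. ennreal (exp (- t * real u)))"

definition bowen_measure ::
    "'m::metric_space set \<Rightarrow> real \<Rightarrow> real \<Rightarrow> ('m \<Rightarrow> 'm) \<Rightarrow> ennreal" where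
  "bowen_measure E t r f = lim (\<lambda>n. bowen_pre E t n r f)"

definition entropy_at_scale :: "'m::metric_space set \<Rightarrow> real \<Rightarrow> ('m \<Rightarrow> 'm) \<Rightarrow> ereal" where
  "entropy_at_scale E r f = Inf {ereal t | t. t \<ge> 0 \<and> bowen_measure E t r f = 0}"

definition htop :: "('m::metric_space \<Rightarrow> 'm) \<Rightarrow> 'm set \<Rightarrow> ereal" where
  "htop f E = Lim (at_right 0) (\<lambda>r. entropy_at_scale E r f)"

text \<open>Both limits exist, by monotonicity.\<close>

lemma bowen_pre_mono: "m \<le> n \<Longrightarrow> bowen_pre E t m r f \<le> bowen_pre E t n r f"
  unfolding bowen_pre_def
  by (rule INF_superset_mono[OF _ order_refl]) (fastforce simp: bowen_covers_def)

lemma bowen_pre_tendsto: "(\<lambda>n. bowen_pre E t n r f) \<longlonglongrightarrow> (SUP n. bowen_pre E t n r f)"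
  by (rule LIMSEQ_SUP) (simp add: incseq_def bowen_pre_mono)

lemma bowen_measure_eq_SUP: "bowen_measure E t r f = (SUP n. bowen_pre E t n r f)"
  unfolding bowen_measure_def by (rule limI[OF bowen_pre_tendsto])

lemma bowen_measure_antimono:
  assumes "r \<le> s"
  shows "bowen_measure E t s f \<le> bowen_measure E t r f"
proof -
  have "bowen_ball f u x r \<subseteq> bowen_ball f u x s" for u x
    using assms by (auto simp: bowen_ball_def intro: less_le_trans)
  then have "(\<Union>(x, u)\<in>K. bowen_ball f u x r) \<subseteq> (\<Union>(x, u)\<in>K. bowen_ball f u x s)" for K
    by (intro UN_mono) auto
  then have "bowen_covers E n r f \<subseteq> bowen_covers E n s f" for n
    unfolding bowen_covers_def
    by (intro Collect_mono impI conj_mono) (assumption | erule order_trans)+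
  then have "bowen_pre E t n s f \<le> bowen_pre E t n r f" for n
    unfolding bowen_pre_def by (rule INF_superset_mono[OF _ order_refl])
  then show ?thesis
    unfolding bowen_measure_eq_SUP by (rule SUP_mono')
qed

lemma entropy_at_scale_antimono:
  assumes "r \<le> s"
  shows "entropy_at_scale E s f \<le> entropy_at_scale E r f"
  unfolding entropy_at_scale_def
proof (intro Inf_superset_mono subsetI)
  fix a assume "a \<in> {ereal t | t. t \<ge> 0 \<and> bowen_measure E t r f = 0}"
  then obtain t where "a = ereal t" "t \<ge> 0" "bowen_measure E t r f = 0" by blast
  moreover have "bowen_measure E t s f = 0"
    using bowen_measure_antimono[OF assms, of E t f] calculation(3) by simp
  ultimately show "a \<in> {ereal t | t. t \<ge> 0 \<and> bowen_measure E t s f = 0}" by blast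
qed

lemma entropy_at_scale_tendsto:
  "((\<lambda>r. entropy_at_scale E r f) \<longlongrightarrow> (SUP r\<in>{0<..}. entropy_at_scale E r f)) (at_right 0)"
proof (rule order_tendstoI)
  fix a assume "a < (SUP r\<in>{0<..}. entropy_at_scale E r f)"
  then obtain s where s: "s > 0" "a < entropy_at_scale E s f" by (auto simp: less_SUP_iff)
  have "a < entropy_at_scale E r f" if "r < s" for r
    using entropy_at_scale_antimono[of r s E f] s that by (meson less_imp_le less_le_trans)
  then show "\<forall>\<^sub>F r in at_right 0. a < entropy_at_scale E r f"
    using s(1) by (auto simp: eventually_at_right_field)
next
  fix a assume a: "(SUP r\<in>{0<..}. entropy_at_scale E r f) < a"
  have "entropy_at_scale E r f < a" if "r > 0" for r
    using SUP_upper[of r "{0<..}" "\<lambda>r. entropy_at_scale E r f"] a that by (auto intro: le_less_trans)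
  then show "\<forall>\<^sub>F r in at_right 0. entropy_at_scale E r f < a"
    using eventually_at_right_less by (rule eventually_mono[rotated])
qed

lemma htop_eq_SUP: "htop f E = (SUP r\<in>{0<..}. entropy_at_scale E r f)"
  unfolding htop_def by (rule tendsto_Lim[OF _ entropy_at_scale_tendsto]) simp

end

theory Submission
  imports Defs
begin

text \<open>
  A map is rich at level \<open>k\<close> if some iterate \<open>f\<^sup>p\<close> has a horseshoe with \<open>2Q\<close> symbols, where
  \<open>ln Q / p \<ge> k\<close>, whose box is disjoint from its first \<open>p - 1\<close> images. The horseshoe is stretched in one
  direction only, so its itineraries are found by the intermediate value theorem along a curve, and
  the defining conditions are open in the \<open>C\<^sup>0\<close> topology. Given a weight, choose a residue class \<open>j\<close>
  modulo \<open>p\<close> on which it has positive upper mean, and prescribe the parity of the symbol at time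
  \<open>pk + j\<close> by the sign of the weight there; a function equal to \<open>1\<close> and \<open>-1\<close> on the even and odd
  slabs and \<open>0\<close> on the other images of the box correlates with the weight along such orbits, and
  the \<open>Q\<close> remaining choices per period give Bowen entropy at least \<open>ln Q / p\<close>.

  For density, start from an orbit segment that returns to a small chart ball. A homeomorphism \<open>f\<close>
  is composed with one supported in this ball that moves finitely many points of the image of a
  short segment to alternating sides of the box and then squeezes the ball onto the axis of the
  box; no local model of \<open>f\<close> is needed. A continuous map may collapse the segment, so there \<open>f\<close> is
  replaced near every point of the orbit. The Baire category theorem concludes.
\<close>

section \<open>Entropy of coded sets\<close>

text \<open>The maps are only continuous, so no contraction is available: an itinerary is realised
  by some point, which need not be unique, and only existence and separation of itineraries are
  used. Splitting the 2Q symbols into Q pairs lets the weight dictate the parity while the pair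
  stays free. The horseshoe itself does not depend on the weight, so one residual set serves all
  weights, and countably many open dense sets suffice. The box must avoid its first p - 1 images
  because the weight is uncontrolled outside the chosen residue class: there the correlating
  function has to vanish, or those terms could cancel the gain.

  The return time p comes from the dynamics and cannot be prescribed. Hence Q is chosen after p;
  this costs nothing, since the number of foldings inside a small ball does not affect the
  \<open>C0\<close> distance. For homeomorphisms the folding needs dimension at least 2, where
  finitely many points can be carried to alternating sides regardless of their order.\<close>

lemma continuous_on_funpow:
  fixes f :: "'a::topological_space \<Rightarrow> 'a"
  assumes "continuous_on UNIV f"
  shows "continuous_on S (f ^^ n)"
proof -
  have "continuous_on UNIV (f ^^ n)"
  proof (induction n)
    case (Suc n)
    then show ?case
      using continuous_on_compose[OF Suc continuous_on_subset[OF assms subset_UNIV]] by simp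
  qed (simp add: id_def)
  then show ?thesis by (rule continuous_on_subset) simp
qed

lemma continuous_crossing_subinterval:
  fixes w :: "real \<Rightarrow> real"
  assumes w: "continuous_on {s..t} w" and "s \<le> t" "w s \<le> a" "b \<le> w t" "a \<le> b"
  obtains s' t' where "s \<le> s'" "s' \<le> t'" "t' \<le> t" "w s' = a" "w t' = b"
    "\<And>x. x \<in> {s'..t'} \<Longrightarrow> a \<le> w x \<and> w x \<le> b"
proof -
  let ?T = "{x\<in>{s..t}. b \<le> w x}"
  have cT: "compact ?T"
    using continuous_closed_preimage[OF w closed_atLeastAtMost closed_atLeast[of b]]
    by (auto simp: compact_eq_bounded_closed vimage_def Int_def
        intro: bounded_subset[OF bounded_closed_interval[of s t]])
  have "?T \<noteq> {}" using assms by auto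
  then obtain t' where t': "t' \<in> ?T" "\<And>x. x \<in> ?T \<Longrightarrow> t' \<le> x"
    using compact_attains_inf[OF cT] by blast
  have "\<exists>x\<ge>s. x \<le> t' \<and> w x = b"
    by (rule IVT'[OF _ _ _ continuous_on_subset[OF w]]) (use t' assms in auto)
  then obtain x where "s \<le> x" "x \<le> t'" "w x = b" by blast
  then have wt': "w t' = b" using t'(1) t'(2)[of x] by auto
  let ?S = "{x\<in>{s..t'}. w x \<le> a}"
  have w': "continuous_on {s..t'} w" by (rule continuous_on_subset[OF w]) (use t' in auto)
  have cS: "compact ?S"
    using continuous_closed_preimage[OF w' closed_atLeastAtMost closed_atMost[of a]]
    by (auto simp: compact_eq_bounded_closed vimage_def Int_def
        intro: bounded_subset[OF bounded_closed_interval[of s t']])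
  have "?S \<noteq> {}" using assms t' by auto
  then obtain s' where s': "s' \<in> ?S" "\<And>x. x \<in> ?S \<Longrightarrow> x \<le> s'"
    using compact_attains_sup[OF cS] by blast
  have "\<exists>x\<ge>s'. x \<le> t' \<and> w x = a"
    by (rule IVT'[OF _ _ _ continuous_on_subset[OF w']]) (use s' wt' assms in auto)
  then obtain x where "s' \<le> x" "x \<le> t'" "w x = a" by blast
  then have ws': "w s' = a" using s'(1) s'(2)[of x] by auto
  have "a \<le> w x \<and> w x \<le> b" if "x \<in> {s'..t'}" for x
  proof
    show "a \<le> w x" using that s' ws' s'(2)[of x] by fastforce
    show "w x \<le> b" using that s' t' wt' t'(2)[of x] by fastforce
  qed
  then show ?thesis using that[of s' t'] s' t' ws' wt' by auto
qed

text \<open>Turns a positive upper limit into one threshold exceeded infinitely often, a form to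
  which the pigeonhole principle applies.\<close>

lemma limsup_pos_iff_frequently:
  fixes X :: "nat \<Rightarrow> real"
  shows "limsup (\<lambda>n. ereal (X n)) > 0 \<longleftrightarrow> (\<exists>e>0. \<exists>\<^sub>F n in sequentially. e < X n)"
proof
  assume "limsup (\<lambda>n. ereal (X n)) > 0"
  then obtain e where e: "0 < ereal e" "ereal e < limsup (\<lambda>n. ereal (X n))"
    using ereal_dense2 by blast
  have "\<exists>\<^sub>F n in sequentially. e < X n"
  proof (rule ccontr)
    assume "\<not> (\<exists>\<^sub>F n in sequentially. e < X n)"
    then have "\<forall>\<^sub>F n in sequentially. ereal (X n) \<le> ereal e" by (simp add: not_frequently not_less)
    from Limsup_bounded[OF this] e show False by simp
  qed
  with e show "\<exists>e>0. \<exists>\<^sub>F n in sequentially. e < X n" by auto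
next
  assume "\<exists>e>0. \<exists>\<^sub>F n in sequentially. e < X n"
  then obtain e where e: "e > 0" "\<exists>\<^sub>F n in sequentially. e < X n" by blast
  show "limsup (\<lambda>n. ereal (X n)) > 0"
  proof (rule ccontr)
    assume "\<not> limsup (\<lambda>n. ereal (X n)) > 0"
    then have "limsup (\<lambda>n. ereal (X n)) < ereal e" using e(1) by (simp add: not_less order_le_less_trans)
    then have "\<forall>\<^sub>F n in sequentially. X n < e" using Limsup_lessD by fastforce
    then have "\<forall>\<^sub>F n in sequentially. \<not> e < X n" by (auto elim: eventually_mono)
    with e(2) show False by (simp add: frequently_def)
  qed
qed

text \<open>The sum splits into p class sums, so whenever the mean exceeds e some class contributes
  more than e/p. As there are finitely many classes, one of them does so for infinitely many
  N.\<close>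

lemma weight_residue_class:
  assumes "nontrivial_weight \<theta>" "0 < p"
  obtains j e where "j < p" "0 < e"
    "\<exists>\<^sub>F N in sequentially. e < 1 / real N * (\<Sum>n | n < N \<and> n mod p = j. \<bar>\<theta> n\<bar>)"
proof -
  obtain e where e: "e > 0" "\<exists>\<^sub>F N in sequentially. e < 1 / real N * (\<Sum>n<N. \<bar>\<theta> n\<bar>)"
    using assms(1) by (auto simp: nontrivial_weight_def limsup_pos_iff_frequently)
  have "\<exists>\<^sub>F N in sequentially. \<exists>j\<in>{..<p}.
      e / p < 1 / real N * (\<Sum>n | n < N \<and> n mod p = j. \<bar>\<theta> n\<bar>)"
  proof (rule frequently_elim1[OF e(2)], rule ccontr)
    fix N assume N: "e < 1 / real N * (\<Sum>n<N. \<bar>\<theta> n\<bar>)"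
      and "\<not> (\<exists>j\<in>{..<p}. e / p < 1 / real N * (\<Sum>n | n < N \<and> n mod p = j. \<bar>\<theta> n\<bar>))"
    then have le: "1 / real N * (\<Sum>n | n < N \<and> n mod p = j. \<bar>\<theta> n\<bar>) \<le> e / p" if "j < p" for j
      using that by (auto simp: not_less)
    have "(\<Sum>n<N. \<bar>\<theta> n\<bar>) = (\<Sum>j<p. \<Sum>n | n \<in> {..<N} \<and> n mod p = j. \<bar>\<theta> n\<bar>)"
      by (rule sum.group[symmetric]) (use assms(2) in auto)
    then have "1 / real N * (\<Sum>n<N. \<bar>\<theta> n\<bar>) =
        (\<Sum>j<p. 1 / real N * (\<Sum>n | n < N \<and> n mod p = j. \<bar>\<theta> n\<bar>))"
      by (simp add: sum_distrib_left)
    also have "\<dots> \<le> (\<Sum>j<p. e / p)" by (rule sum_mono) (use le in auto)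
    also have "\<dots> = e" using assms(2) by simp
    finally show False using N by simp
  qed
  then have "\<exists>j\<in>{..<p}. \<exists>\<^sub>F N in sequentially.
      e / p < 1 / real N * (\<Sum>n | n < N \<and> n mod p = j. \<bar>\<theta> n\<bar>)"
    by (rule frequently_bex_finite[rotated]) simp
  then show ?thesis using that[of _ "e / p"] e(1) assms(2) by auto
qed

section \<open>Counting words: a Kraft inequality for covers\<close>

lemma card_agreeing_words_le:
  fixes S :: "(nat \<Rightarrow> nat) set"
  assumes "S \<subseteq> PiE {..<L} (\<lambda>_. {..<Q})" "l \<le> L"
    and agree: "\<And>s s' k. s \<in> S \<Longrightarrow> s' \<in> S \<Longrightarrow> k < l \<Longrightarrow> s k = s' k"
  shows "card S \<le> Q ^ (L - l)"
proof -
  have "inj_on (\<lambda>s. restrict s {l..<L}) S"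
  proof (rule inj_onI)
    fix s s' assume s: "s \<in> S" "s' \<in> S" and eq: "restrict s {l..<L} = restrict s' {l..<L}"
    show "s = s'"
    proof
      fix k
      consider "k < l" | "l \<le> k" "k < L" | "L \<le> k" by linarith
      then show "s k = s' k"
      proof cases
        case 2
        then show ?thesis using fun_cong[OF eq, of k] by simp
      next
        case 3
        then show ?thesis using s assms(1) by (metis PiE_arb in_mono lessThan_iff not_less)
      qed (use agree s in auto)
    qed
  qed
  moreover have "(\<lambda>s. restrict s {l..<L}) ` S \<subseteq> PiE {l..<L} (\<lambda>_. {..<Q})"
    using assms(1) by (fastforce simp: PiE_def Pi_def)
  ultimately have "card S \<le> card (PiE {l..<L} (\<lambda>_. {..<Q}))"
    by (intro card_inj_on_le) (auto intro: finite_PiE)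
  also have "\<dots> = Q ^ (L - l)" by (simp add: card_PiE)
  finally show ?thesis .
qed

text \<open>Count words of the maximal length L: each set \<open>C i\<close> accounts for at most
  \<open>Q ^ (L - l i)\<close> of the \<open>Q ^ L\<close> words. Covering replaces the disjointness
  of a prefix code, so the inequality points the other way.\<close>

lemma kraft_inequality:
  fixes C :: "'i \<Rightarrow> (nat \<Rightarrow> nat) set" and l :: "'i \<Rightarrow> nat"
  assumes "finite I" "0 < Q"
    and cover: "{s. \<forall>k. s k < Q} \<subseteq> (\<Union>i\<in>I. C i)"
    and agree: "\<And>i s s' k. \<lbrakk>i \<in> I; s \<in> C i; s' \<in> C i; k < l i\<rbrakk> \<Longrightarrow> s k = s' k"
  shows "1 \<le> (\<Sum>i\<in>I. 1 / real Q ^ l i)"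
proof -
  define L where "L = Max (insert 0 (l ` I))"
  have lL: "l i \<le> L" if "i \<in> I" for i using that assms(1) by (auto simp: L_def)
  let ?P = "PiE {..<L} (\<lambda>_. {..<Q})"
  \<comment> \<open>Padding with the letter 0, admissible since Q is positive, turns a finite word
    into a sequence to which the cover applies.\<close>
  define ext :: "(nat \<Rightarrow> nat) \<Rightarrow> nat \<Rightarrow> nat" where "ext s = (\<lambda>k. if k < L then s k else 0)" for s
  define A where "A i = {s \<in> ?P. ext s \<in> C i}" for i
  have "?P \<subseteq> (\<Union>i\<in>I. A i)"
  proof
    fix s assume s: "s \<in> ?P"
    then have "\<forall>k. ext s k < Q" using assms(2) by (auto simp: ext_def)
    with cover s show "s \<in> (\<Union>i\<in>I. A i)" by (force simp: A_def)
  qed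
  then have "card ?P \<le> card (\<Union>i\<in>I. A i)"
    by (rule card_mono[rotated]) (use assms(1) in \<open>auto simp: A_def intro!: finite_Collect_conjI finite_PiE\<close>)
  also have "\<dots> \<le> (\<Sum>i\<in>I. card (A i))" by (rule card_UN_le[OF assms(1)])
  also have "\<dots> \<le> (\<Sum>i\<in>I. Q ^ (L - l i))"
  proof (rule sum_mono)
    fix i assume i: "i \<in> I"
    show "card (A i) \<le> Q ^ (L - l i)"
    proof (rule card_agreeing_words_le)
      fix s s' k assume "s \<in> A i" "s' \<in> A i" "k < l i"
      then show "s k = s' k" using agree[OF i, of "ext s" "ext s'" k] lL[OF i] by (auto simp: A_def ext_def)
    qed (use lL[OF i] in \<open>auto simp: A_def\<close>)
  qed
  finally have "real (Q ^ L) \<le> real (\<Sum>i\<in>I. Q ^ (L - l i))"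
    by (simp add: card_PiE del: of_nat_sum of_nat_power)
  also have "\<dots> = real Q ^ L * (\<Sum>i\<in>I. 1 / real Q ^ l i)"
    unfolding sum_distrib_left of_nat_sum of_nat_power
    by (rule sum.cong) (use lL assms(2) in \<open>auto simp: power_diff\<close>)
  finally show ?thesis using assms(2) by simp
qed

section \<open>Bowen entropy: monotonicity and a lower bound by coding\<close>

lemma bowen_covers_antimono: "E \<subseteq> E' \<Longrightarrow> bowen_covers E' n r f \<subseteq> bowen_covers E n r f"
  by (auto simp: bowen_covers_def)

lemma entropy_at_scale_mono:
  assumes "E \<subseteq> E'"
  shows "entropy_at_scale E r f \<le> entropy_at_scale E' r f"
proof -
  have "bowen_measure E t r f \<le> bowen_measure E' t r f" for t
    unfolding bowen_measure_eq_SUP bowen_pre_def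
    by (intro SUP_mono' INF_superset_mono bowen_covers_antimono assms order_refl)
  then show ?thesis
    unfolding entropy_at_scale_def
    by (intro Inf_superset_mono Collect_mono) (metis le_zero_eq)
qed

lemma htop_mono: "E \<subseteq> E' \<Longrightarrow> htop f E \<le> htop f E'"
  unfolding htop_eq_SUP by (intro SUP_mono' entropy_at_scale_mono)

lemma entropy_at_scale_le_htop: "0 < r \<Longrightarrow> entropy_at_scale E r f \<le> htop f E"
  unfolding htop_eq_SUP by (intro SUP_upper) simp

lemma open_bowen_ball:
  assumes "continuous_on UNIV f"
  shows "open (bowen_ball f u x r)"
proof -
  have "bowen_ball f u x r = (\<Inter>i<u. (f ^^ i) -` ball ((f ^^ i) x) r)"
    by (auto simp: bowen_ball_def)
  also have "open \<dots>"
    by (intro open_INT ballI open_vimage continuous_on_funpow assms) auto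
  finally show ?thesis .
qed

text \<open>Compactness reduces the covers in the definition of Bowen entropy to finite ones.\<close>

lemma entropy_at_scale_ge_coding:
  fixes f :: "'m::metric_space \<Rightarrow> 'm" and Q p :: nat and z :: "(nat \<Rightarrow> nat) \<Rightarrow> 'm"
  assumes f: "continuous_on UNIV f" and E: "compact E" and "0 < Q" "0 < p"
    and z: "\<And>s. (\<And>k. s k < Q) \<Longrightarrow> z s \<in> E"
    and sep: "\<And>s s' u x k. \<lbrakk>\<And>k. s k < Q; \<And>k. s' k < Q; z s \<in> bowen_ball f u x r;
        z s' \<in> bowen_ball f u x r; k < u div p\<rbrakk> \<Longrightarrow> s k = s' k"
  shows "ereal (ln Q / p) \<le> entropy_at_scale E r f"
  unfolding entropy_at_scale_def
proof (rule Inf_greatest, clarify)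
  fix t :: real assume t: "0 \<le> t" "bowen_measure E t r f = 0"
  show "ereal (ln Q / p) \<le> ereal t"
  proof (rule ccontr)
    assume "\<not> ereal (ln Q / p) \<le> ereal t"
    then have tlt: "t < ln Q / p" by simp
    \<comment> \<open>Order bound 0 is enough: \<open>bowen_measure\<close> is the supremum over all
      order bounds, so one positive value contradicts its vanishing.\<close>
    have "ennreal (1 / Q) \<le> bowen_pre E t 0 r f"
      unfolding bowen_pre_def
    proof (rule INF_greatest)
      fix K assume K: "K \<in> bowen_covers E 0 r f"
      then have "E \<subseteq> (\<Union>(x,u)\<in>K. bowen_ball f u x r)" by (simp add: bowen_covers_def)
      then obtain F where F: "F \<subseteq> K" "finite F" "E \<subseteq> (\<Union>(x,u)\<in>F. bowen_ball f u x r)"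
        by (rule compactE_image[OF E, rotated]) (auto intro: open_bowen_ball[OF f])
      define C where "C = (\<lambda>(x,u). {s. (\<forall>k. s k < Q) \<and> z s \<in> bowen_ball f u x r})"
      have "1 \<le> (\<Sum>i\<in>F. 1 / real Q ^ (snd i div p))"
      proof (rule kraft_inequality[OF F(2) \<open>0 < Q\<close>])
        show "{s. \<forall>k. s k < Q} \<subseteq> (\<Union>i\<in>F. C i)" using F(3) z by (fastforce simp: C_def)
        fix i s s' k assume "i \<in> F" "s \<in> C i" "s' \<in> C i" "k < snd i div p"
        then show "s k = s' k" using sep[of s s' "snd i" "fst i" k] by (auto simp: C_def split: prod.splits)
      qed
      \<comment> \<open>Rounding the order down to a multiple of p loses less than one period, hence
        at most one factor Q; this is why the bound is 1/Q and not 1.\<close>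
      also have "\<dots> \<le> (\<Sum>i\<in>F. Q * exp (- t * real (snd i)))"
      proof (rule sum_mono)
        fix i assume "i \<in> F"
        define u where "u = snd i"
        have "real u \<le> p * (u div p) + p"
          using mod_less_divisor[OF \<open>0 < p\<close>, of u] div_mult_mod_eq[of u p]
          by (metis add_le_cancel_left less_imp_le mult.commute of_nat_add of_nat_le_iff of_nat_mult)
        then have "t * u \<le> (ln Q / p) * (p * (u div p) + p)"
          using tlt t(1) by (intro mult_mono) auto
        also have "\<dots> = (u div p + 1) * ln Q" using \<open>0 < p\<close> by (simp add: field_simps)
        finally have "exp (t * u) \<le> exp ((u div p + 1) * ln Q)" by simp
        also have "\<dots> = Q * real Q ^ (u div p)"
          using \<open>0 < Q\<close> by (subst exp_of_nat_mult) simp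
        finally have "exp (t * u) \<le> Q * real Q ^ (u div p)" .
        then show "1 / real Q ^ (snd i div p) \<le> Q * exp (- t * real (snd i))"
          using \<open>0 < Q\<close> by (simp add: u_def[symmetric] exp_minus field_simps)
      qed
      also have "\<dots> = Q * (\<Sum>i\<in>F. exp (- t * real (snd i)))" by (simp add: sum_distrib_left)
      finally have "1 / Q \<le> (\<Sum>i\<in>F. exp (- t * real (snd i)))" using \<open>0 < Q\<close> by (simp add: field_simps)
      then have "ennreal (1 / Q) \<le> (\<Sum>i\<in>F. ennreal (exp (- t * real (snd i))))"
        by (subst sum_ennreal) (auto intro: ennreal_leI)
      also have "\<dots> = (\<Sum>\<^sub>\<infinity>(x, u)\<in>F. ennreal (exp (- t * real u)))"
        using F(2) by (simp add: case_prod_beta)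
      also have "\<dots> \<le> (\<Sum>\<^sub>\<infinity>(x, u)\<in>K. ennreal (exp (- t * real u)))"
        by (rule infsum_mono_neutral) (use F(1) in \<open>auto intro: nonneg_summable_on_complete\<close>)
      finally show "ennreal (1 / Q) \<le> (\<Sum>\<^sub>\<infinity>(x, u)\<in>K. ennreal (exp (- t * real u)))" .
    qed
    also have "\<dots> \<le> bowen_measure E t r f" unfolding bowen_measure_eq_SUP by (rule SUP_upper) simp
    finally show False using t(2) \<open>0 < Q\<close> by simp
  qed
qed

section \<open>Horseshoes\<close>

text \<open>
  A horseshoe with \<open>N\<close> symbols for \<open>f\<^sup>p\<close>: the function \<open>u\<close> is the expanding coordinate of the box
  \<open>V\<close>, the \<open>i\<close>-th slab is \<open>{2i \<le> u \<le> 2i + 1}\<close>, and its two faces are mapped beyond the opposite ends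
  \<open>u = 0\<close> and \<open>u = 2N\<close> of the box. Since images of slabs stay in \<open>W\<close>, they can leave \<open>V\<close> only through
  these ends.
\<close>

locale horseshoe =
  fixes f :: "'m::metric_space \<Rightarrow> 'm" and p N :: nat
    and V W :: "'m set" and u :: "'m \<Rightarrow> real" and \<gamma> :: "real \<Rightarrow> 'm"
  assumes p: "0 < p"
    and V: "compact V" and W: "open W" and u: "continuous_on (V \<union> W) u"
    and strip: "\<And>z. \<lbrakk>z \<in> W; 0 \<le> u z; u z \<le> 2 * N\<rbrakk> \<Longrightarrow> z \<in> V"
    and \<gamma>: "continuous_on {0..1} \<gamma>" "\<gamma> ` {0..1} \<subseteq> V" "u (\<gamma> 0) \<le> 0" "2 * N \<le> u (\<gamma> 1)"
    and slab: "\<And>i z. \<lbrakk>i < N; z \<in> V; 2 * real i \<le> u z; u z \<le> 2 * real i + 1\<rbrakk> \<Longrightarrow> (f ^^ p) z \<in> W"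
    and left: "\<And>i z. \<lbrakk>i < N; z \<in> V; u z = 2 * real i\<rbrakk> \<Longrightarrow> u ((f ^^ p) z) < 0"
    and right: "\<And>i z. \<lbrakk>i < N; z \<in> V; u z = 2 * real i + 1\<rbrakk> \<Longrightarrow> 2 * N < u ((f ^^ p) z)"
    and away: "\<And>l z. \<lbrakk>0 < l; l < p; z \<in> V\<rbrakk> \<Longrightarrow> (f ^^ l) z \<notin> V"

text \<open>Continuity is kept out of \<open>horseshoe\<close>, so that stability can be stated for
  every map uniformly close to f, continuous or not.\<close>

locale continuous_horseshoe = horseshoe f p N V W u \<gamma>
  for f :: "'m::metric_space \<Rightarrow> 'm" and p N V W u \<gamma> +
  assumes f: "continuous_on UNIV f" and cpt: "compact (UNIV :: 'm set)"
begin

definition K :: "nat \<Rightarrow> 'm set" where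
  "K i = {z \<in> V. 2 * real i \<le> u z \<and> u z \<le> 2 * real i + 1}"

lemma closed_K: "closed (K i)"
proof -
  have "closed (V \<inter> u -` {2 * real i..2 * real i + 1})"
    by (intro continuous_closed_preimage continuous_on_subset[OF u] compact_imp_closed V) auto
  also have "V \<inter> u -` {2 * real i..2 * real i + 1} = K i" by (auto simp: K_def)
  finally show ?thesis .
qed

lemma K_disjoint: "i \<noteq> j \<Longrightarrow> K i \<inter> K j = {}"
  by (auto simp: K_def)

text \<open>Induction on a subarc of \<gamma> whose current image runs from \<open>u \<le> 0\<close>
  to \<open>u \<ge> 2N\<close>. Such an image crosses the prescribed slab; cutting the arc down to
  this crossing, \<open>left\<close> and \<open>right\<close> make the next image cross the whole
  range again. The images overshoot the box, so the invariant places them in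
  \<open>V \<union> W\<close> and not in \<open>V\<close>.\<close>

lemma finite_itinerary:
  assumes s: "\<And>k. s k < N"
  shows "\<exists>a b. 0 \<le> a \<and> a \<le> b \<and> b \<le> 1 \<and>
    (\<forall>k<n. \<forall>x\<in>{a..b}. (f ^^ (p * k)) (\<gamma> x) \<in> K (s k)) \<and>
    (\<forall>x\<in>{a..b}. (f ^^ (p * n)) (\<gamma> x) \<in> V \<union> W) \<and>
    u ((f ^^ (p * n)) (\<gamma> a)) \<le> 0 \<and> 2 * N \<le> u ((f ^^ (p * n)) (\<gamma> b))"
proof (induction n)
  case 0
  show ?case using \<gamma> by (intro exI[of _ 0] exI[of _ 1]) auto
next
  case (Suc n)
  then obtain a b where ab: "0 \<le> a" "a \<le> b" "b \<le> 1"
    and it: "\<And>k x. k < n \<Longrightarrow> x \<in> {a..b} \<Longrightarrow> (f ^^ (p * k)) (\<gamma> x) \<in> K (s k)"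
    and VW: "\<And>x. x \<in> {a..b} \<Longrightarrow> (f ^^ (p * n)) (\<gamma> x) \<in> V \<union> W"
    and ends: "u ((f ^^ (p * n)) (\<gamma> a)) \<le> 0" "2 * N \<le> u ((f ^^ (p * n)) (\<gamma> b))"
    by blast
  define w where "w = (\<lambda>x. u ((f ^^ (p * n)) (\<gamma> x)))"
  have cont: "continuous_on {a..b} (\<lambda>x. (f ^^ (p * n)) (\<gamma> x))"
    by (rule continuous_on_compose2[OF continuous_on_funpow[OF f] continuous_on_subset[OF \<gamma>(1)]])
      (use ab in auto)
  have w: "continuous_on {a..b} w"
    unfolding w_def by (rule continuous_on_compose2[OF u cont]) (rule image_subsetI, rule VW)
  have sN: "2 * real (s n) + 1 \<le> 2 * N" using s[of n] by linarith
  obtain a' b' where ab': "a \<le> a'" "a' \<le> b'" "b' \<le> b" "w a' = 2 * real (s n)"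
    "w b' = 2 * real (s n) + 1"
    and bet: "\<And>x. x \<in> {a'..b'} \<Longrightarrow> 2 * real (s n) \<le> w x \<and> w x \<le> 2 * real (s n) + 1"
    by (rule continuous_crossing_subinterval[OF w ab(2), of "2 * real (s n)" "2 * real (s n) + 1"])
      (use ends sN in \<open>auto simp: w_def\<close>)
  have K: "(f ^^ (p * n)) (\<gamma> x) \<in> K (s n)" if "x \<in> {a'..b'}" for x
    using bet[OF that] VW[of x] strip[of "(f ^^ (p * n)) (\<gamma> x)"] that ab' sN
    by (auto simp: K_def w_def)
  have step: "(f ^^ (p * Suc n)) x = (f ^^ p) ((f ^^ (p * n)) x)" for x
    by (simp add: funpow_add)
  show ?case
  proof (intro exI conjI allI impI ballI)
    show "0 \<le> a'" "a' \<le> b'" "b' \<le> 1" using ab ab' by auto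
    fix k x assume k: "k < Suc n" and x: "x \<in> {a'..b'}"
    show "(f ^^ (p * k)) (\<gamma> x) \<in> K (s k)"
      using K[OF x] it[of k x] k x ab' by (cases "k = n") auto
  next
    fix x assume x: "x \<in> {a'..b'}"
    show "(f ^^ (p * Suc n)) (\<gamma> x) \<in> V \<union> W"
      unfolding step using K[OF x] slab[OF s[of n]] by (simp add: K_def)
  next
    show "u ((f ^^ (p * Suc n)) (\<gamma> a')) \<le> 0"
      unfolding step using left[OF s[of n], of "(f ^^ (p * n)) (\<gamma> a')"] K[of a'] ab'
      by (simp add: K_def w_def)
    show "2 * N \<le> u ((f ^^ (p * Suc n)) (\<gamma> b'))"
      unfolding step using right[OF s[of n], of "(f ^^ (p * n)) (\<gamma> b')"] K[of b'] ab'
      by (simp add: K_def w_def)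
  qed
qed

lemma closed_preimage_funpow: "closed S \<Longrightarrow> closed {z. (f ^^ n) z \<in> S}"
  using closed_vimage[OF _ continuous_on_funpow[OF f], of S n] by (simp add: vimage_def)

text \<open>The finite itineraries give a decreasing sequence of nonempty closed sets in a compact
  space.\<close>

lemma itinerary:
  assumes s: "\<And>k. s k < N"
  shows "\<exists>z. \<forall>k. (f ^^ (p * k)) z \<in> K (s k)"
proof -
  define C where "C n = {z. \<forall>k\<in>{..<n}. (f ^^ (p * k)) z \<in> K (s k)}" for n
  have "(\<Inter>n. C n) \<noteq> {}"
  proof (rule compact_space_imp_nest)
    show "compact_space (euclidean :: 'm topology)" using cpt by (simp add: compact_space_def)
    have "C n = (\<Inter>k<n. {z. (f ^^ (p * k)) z \<in> K (s k)})" for n by (auto simp: C_def)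
    moreover have "closed (\<Inter>k<n. {z. (f ^^ (p * k)) z \<in> K (s k)})" for n
      by (intro closed_INT ballI closed_preimage_funpow closed_K)
    ultimately show "closedin euclidean (C n)" for n by (simp flip: closed_closedin)
    show "C n \<noteq> {}" for n
    proof -
      obtain a b where "a \<le> b" "\<forall>k<n. \<forall>x\<in>{a..b}. (f ^^ (p * k)) (\<gamma> x) \<in> K (s k)"
        using finite_itinerary[of s n, OF s] by (elim exE conjE) (rule that)
      then have "\<gamma> a \<in> C n" by (simp add: C_def)
      then show ?thesis by blast
    qed
    show "decseq C" by (auto simp: decseq_def C_def)
  qed
  then obtain z where "\<And>n. z \<in> C n" by blast
  then show ?thesis by (intro exI[of _ z]) (auto simp: C_def)
qed

text \<open>Consecutive slabs leave a gap of length 1 in the values of u, so distinct slabs are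
  disjoint compact sets. The factor 2 anticipates two points of one Bowen ball of radius r.\<close>

lemma K_separated:
  "\<exists>r>0. \<forall>i<N. \<forall>j<N. \<forall>z\<in>K i. \<forall>w\<in>K j. dist z w < 2 * r \<longrightarrow> i = j"
proof -
  have "\<exists>e>0. \<forall>z\<in>K i. \<forall>w\<in>K j. e \<le> dist z w" if "i \<noteq> j" for i j
  proof (cases "K i \<times> K j = {}")
    case False
    have "compact (K i \<times> K j)"
      using compact_Int_closed[OF cpt closed_K] by (intro compact_Times) auto
    moreover have "continuous_on (K i \<times> K j) (\<lambda>q. dist (fst q) (snd q))" by (intro continuous_intros)
    ultimately obtain q where q: "q \<in> K i \<times> K j"
      "\<And>q'. q' \<in> K i \<times> K j \<Longrightarrow> dist (fst q) (snd q) \<le> dist (fst q') (snd q')"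
      using continuous_attains_inf[OF _ False] by blast
    then have "0 < dist (fst q) (snd q)" using K_disjoint[OF that] by auto
    moreover have "dist (fst q) (snd q) \<le> dist z w" if "z \<in> K i" "w \<in> K j" for z w
      using q(2)[of "(z, w)"] that by simp
    ultimately show ?thesis by blast
  next
    case True
    then show ?thesis by (intro exI[of _ 1]) auto
  qed
  then have "\<forall>i j. \<exists>e. i \<noteq> j \<longrightarrow> 0 < e \<and> (\<forall>z\<in>K i. \<forall>w\<in>K j. e \<le> dist z w)" by blast
  then obtain e :: "nat \<Rightarrow> nat \<Rightarrow> real" where e: "\<And>i j. i \<noteq> j \<Longrightarrow> 0 < e i j"
    "\<And>i j z w. i \<noteq> j \<Longrightarrow> z \<in> K i \<Longrightarrow> w \<in> K j \<Longrightarrow> e i j \<le> dist z w"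
    unfolding choice_iff by blast
  define D where "D = (\<lambda>(i, j). e i j) ` {(i, j). i < N \<and> j < N \<and> i \<noteq> j}"
  have fin: "finite D" unfolding D_def
    by (rule finite_imageI, rule finite_subset[of _ "{..<N} \<times> {..<N}"]) auto
  \<comment> \<open>The inserted 1 keeps the minimum defined when there is no pair of distinct
    slabs.\<close>
  define r where "r = Min (insert 1 D) / 2"
  have "0 < r" using fin e(1) by (auto simp: r_def D_def)
  moreover have "\<forall>i<N. \<forall>j<N. \<forall>z\<in>K i. \<forall>w\<in>K j. dist z w < 2 * r \<longrightarrow> i = j"
  proof (intro allI impI ballI)
    fix i j z w assume that: "i < N" "j < N" "z \<in> K i" "w \<in> K j" "dist z w < 2 * r"
    show "i = j"
    proof (rule ccontr)
      assume "i \<noteq> j"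
      then have "e i j \<in> D" using that by (auto simp: D_def)
      then have "2 * r \<le> e i j" using fin by (auto simp: r_def)
      with e(2)[OF \<open>i \<noteq> j\<close> that(3,4)] that(5) show False by simp
    qed
  qed
  ultimately show ?thesis by blast
qed

text \<open>The even slabs, the odd slabs and the union of the intermediate images of V are disjoint
  closed sets; the difference of two Urysohn functions has the required values.\<close>

lemma sign_function:
  "\<exists>\<phi>. continuous_on UNIV \<phi> \<and> (\<forall>i<N. \<forall>z\<in>K i. \<phi> z = (if even i then 1 else - 1 :: real)) \<and>
     (\<forall>l z. 0 < l \<longrightarrow> l < p \<longrightarrow> z \<in> V \<longrightarrow> \<phi> ((f ^^ l) z) = 0)"
proof -
  define A where "A = (\<Union>i\<in>{i. i < N \<and> even i}. K i)"
  define B where "B = (\<Union>i\<in>{i. i < N \<and> odd i}. K i)"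
  define Z where "Z = (\<Union>l\<in>{0<..<p}. (f ^^ l) ` V)"
  have [simp]: "closed A" "closed B" unfolding A_def B_def by (intro closed_UN ballI closed_K; simp)+
  have [simp]: "closed Z" unfolding Z_def
    by (intro closed_UN ballI compact_imp_closed compact_continuous_image V continuous_on_funpow f) simp
  have VZ: "V \<inter> Z = {}" using away unfolding Z_def by auto
  have K_eq: "i = j" if "z \<in> K i" "z \<in> K j" for i j z using K_disjoint[of i j] that by auto
  have K_V: "K i \<subseteq> V" for i unfolding K_def by auto
  have AB: "disjnt A (B \<union> Z)" "disjnt B (A \<union> Z)"
    using K_eq VZ K_V unfolding disjnt_iff A_def B_def by blast+
  have n: "normal_space (euclidean :: 'm topology)"
    by (simp add: metrizable_imp_normal_space metrizable_space_euclidean)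
  have clo: "closedin euclidean A" "closedin euclidean B"
    "closedin euclidean (B \<union> Z)" "closedin euclidean (A \<union> Z)"
    by (auto intro!: closed_Un simp flip: closed_closedin)
  obtain g :: "'m \<Rightarrow> real" where g: "continuous_map euclidean euclideanreal g" "g ` A \<subseteq> {1}" "g ` (B \<union> Z) \<subseteq> {0}"
    by (rule Urysohn_lemma_alt[OF n clo(1,3) AB(1)])
  obtain h :: "'m \<Rightarrow> real" where h: "continuous_map euclidean euclideanreal h" "h ` B \<subseteq> {1}" "h ` (A \<union> Z) \<subseteq> {0}"
    by (rule Urysohn_lemma_alt[OF n clo(2,4) AB(2)])
  show ?thesis
  proof (intro exI[of _ "\<lambda>z. g z - h z"] conjI allI impI ballI)
    show "continuous_on UNIV (\<lambda>z. g z - h z)"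
      using g(1) h(1) by (intro continuous_on_diff) simp_all
    fix i z assume "i < N" "z \<in> K i"
    then have "z \<in> (if even i then A else B)" by (auto simp: A_def B_def)
    with g h show "g z - h z = (if even i then 1 else - 1)"
      by (auto simp: image_subset_iff split: if_splits)
  next
    fix l z assume "0 < l" "l < p" "z \<in> V"
    then have "(f ^^ l) z \<in> Z" by (auto simp: Z_def)
    with g h show "g ((f ^^ l) z) - h ((f ^^ l) z) = 0" by (simp add: image_subset_iff)
  qed
qed

theorem htop_non_orthogonal_ge:
  assumes \<theta>: "nontrivial_weight \<theta>" and N: "N = 2 * Q" "0 < Q"
  shows "ereal (ln (real Q) / real p) \<le> htop f (non_orthogonal \<theta> f)" "non_orthogonal \<theta> f \<noteq> {}"
proof -
  obtain j e where j: "j < p" and e: "0 < e"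
    "\<exists>\<^sub>F M in sequentially. e < 1 / real M * (\<Sum>n | n < M \<and> n mod p = j. \<bar>\<theta> n\<bar>)"
    using weight_residue_class[OF \<theta> p] by blast
  obtain r where r: "0 < r"
    "\<forall>i<N. \<forall>i'<N. \<forall>z\<in>K i. \<forall>w\<in>K i'. dist z w < 2 * r \<longrightarrow> i = i'"
    using K_separated by blast
  obtain \<phi> :: "'m \<Rightarrow> real" where \<phi>: "continuous_on UNIV \<phi>"
    and \<phi>_K: "\<forall>i<N. \<forall>z\<in>K i. \<phi> z = (if even i then 1 else - 1)"
    and \<phi>_0: "\<forall>l z. 0 < l \<longrightarrow> l < p \<longrightarrow> z \<in> V \<longrightarrow> \<phi> ((f ^^ l) z) = 0"
    using sign_function by blast
  \<comment> \<open>The orbit to be studied starts at \<open>(f ^^ (p - j)) z\<close>, so its time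
    \<open>p * k + j\<close> is time \<open>p * Suc k\<close> of z. Hence the index shift; the
    symbol at time 0 of z precedes the start, and its parity is arbitrary.\<close>
  define P :: "nat \<Rightarrow> nat"
    where "P k = (case k of 0 \<Rightarrow> 0 | Suc k \<Rightarrow> if 0 \<le> \<theta> (p * k + j) then 0 else 1)" for k
  have P: "P k \<le> 1" for k by (simp add: P_def split: nat.split)
  have PN: "2 * q + P k < N" if "q < Q" for q k using P[of k] that N(1) by linarith
  \<comment> \<open>All points with the prescribed parities are taken, and not only the coded points
    selected later: this set is closed, so E is compact, as the coding bound requires.\<close>
  define Z where "Z = {z. \<forall>k. \<exists>q<Q. (f ^^ (p * k)) z \<in> K (2 * q + P k)}"
  define E where "E = (f ^^ (p - j)) ` Z"
  have shift: "(f ^^ n) ((f ^^ (p - j)) z) = (f ^^ (n + (p - j))) z" for n z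
    by (simp add: funpow_add)
  have "Z = (\<Inter>k. \<Union>q\<in>{..<Q}. {z. (f ^^ (p * k)) z \<in> K (2 * q + P k)})" by (auto simp: Z_def)
  then have "closed Z"
    using closed_preimage_funpow[OF closed_K] by (auto intro!: closed_INT closed_UN)
  then have "compact E" unfolding E_def
    using compact_Int_closed[OF cpt \<open>closed Z\<close>]
    by (intro compact_continuous_image continuous_on_funpow f) simp
  have "E \<subseteq> non_orthogonal \<theta> f"
  proof
    fix x assume "x \<in> E"
    then obtain z where z: "\<And>k. \<exists>q<Q. (f ^^ (p * k)) z \<in> K (2 * q + P k)"
      and x: "x = (f ^^ (p - j)) z"
      by (auto simp: E_def Z_def)
    \<comment> \<open>No cancellation occurs: in the class of j the sign of \<phi> matches that of
      the weight, and otherwise \<open>n + (p - j)\<close> is not a multiple of p, so the orbit sits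
      in an intermediate image of V, where \<phi> is 0.\<close>
    have key: "\<theta> n * \<phi> ((f ^^ n) x) = (if n mod p = j then \<bar>\<theta> n\<bar> else 0)" for n
    proof -
      define m where "m = n + (p - j)"
      have fnx: "(f ^^ n) x = (f ^^ (m mod p)) ((f ^^ (p * (m div p))) z)"
        unfolding x shift m_def[symmetric] by (metis comp_apply funpow_add mod_mult_div_eq)
      obtain q where q: "q < Q" "(f ^^ (p * (m div p))) z \<in> K (2 * q + P (m div p))"
        using z by blast
      then have inV: "(f ^^ (p * (m div p))) z \<in> V" by (simp add: K_def)
      show ?thesis
      proof (cases "n mod p = j")
        case True
        define k where "k = n div p"
        have n: "n = p * k + j" unfolding k_def True[symmetric] by simp
        then have "m = p * Suc k" using j by (simp add: m_def)
        then have m: "m mod p = 0" "m div p = Suc k" using p by simp_all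
        have "\<phi> ((f ^^ n) x) = (if even (2 * q + P (Suc k)) then 1 else - 1)"
          using q PN[OF q(1), of "Suc k"] \<phi>_K by (auto simp: fnx m)
        also have "\<dots> = (if 0 \<le> \<theta> n then 1 else - 1)" by (simp add: P_def n)
        finally show ?thesis using True by simp
      next
        case False
        have "m mod p \<noteq> 0"
        proof
          assume "m mod p = 0"
          then obtain k where k: "m = p * k" by (metis mod_0_imp_dvd dvdE)
          then have "n + p = p * k + j" using j by (simp add: m_def)
          then have "(n + p) mod p = (p * k + j) mod p" by simp
          then show False using False j by simp
        qed
        then have "\<phi> ((f ^^ n) x) = 0"
          unfolding fnx using p inV \<phi>_0 by simp
        then show ?thesis using False by simp
      qed
    qed
    have "(\<Sum>n<M. \<theta> n * \<phi> ((f ^^ n) x)) = (\<Sum>n | n < M \<and> n mod p = j. \<bar>\<theta> n\<bar>)" for M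
      unfolding key by (simp add: sum.If_cases Int_def)
    then have "\<exists>\<^sub>F M in sequentially. e < 1 / real M * \<bar>\<Sum>n<M. \<theta> n * \<phi> ((f ^^ n) x)\<bar>"
      using e(2) by (simp add: sum_nonneg)
    then show "x \<in> non_orthogonal \<theta> f"
      using \<phi> e(1) by (auto simp: non_orthogonal_def limsup_pos_iff_frequently)
  qed
  \<comment> \<open>The free symbols start at time p of z, the first visit to V that the shifted
    orbit is certain to see; the slot at time 0 is filled with 0.\<close>
  define \<sigma> :: "(nat \<Rightarrow> nat) \<Rightarrow> nat \<Rightarrow> nat"
    where "\<sigma> s k = (case k of 0 \<Rightarrow> 0 | Suc k \<Rightarrow> s k)" for s k
  have "\<forall>s. \<exists>z. (\<forall>k. s k < Q) \<longrightarrow> (\<forall>k. (f ^^ (p * k)) z \<in> K (2 * \<sigma> s k + P k))"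
  proof
    fix s :: "nat \<Rightarrow> nat"
    show "\<exists>z. (\<forall>k. s k < Q) \<longrightarrow> (\<forall>k. (f ^^ (p * k)) z \<in> K (2 * \<sigma> s k + P k))"
    proof (cases "\<forall>k. s k < Q")
      case True
      then have "2 * \<sigma> s k + P k < N" for k
        by (intro PN) (auto simp: \<sigma>_def N split: nat.split)
      from itinerary[of "\<lambda>k. 2 * \<sigma> s k + P k", OF this] show ?thesis by blast
    qed auto
  qed
  then obtain z where z: "\<And>s k. (\<And>k. s k < Q) \<Longrightarrow> (f ^^ (p * k)) (z s) \<in> K (2 * \<sigma> s k + P k)"
    unfolding choice_iff by blast
  have zE: "(f ^^ (p - j)) (z s) \<in> E" if s: "\<And>k. s k < Q" for s
  proof -
    have "\<exists>q<Q. (f ^^ (p * k)) (z s) \<in> K (2 * q + P k)" for k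
      using z[of s k] s N by (intro exI[of _ "\<sigma> s k"]) (auto simp: \<sigma>_def split: nat.split)
    then show ?thesis by (auto simp: E_def Z_def)
  qed
  have "ereal (ln Q / p) \<le> entropy_at_scale E r f"
  proof (rule entropy_at_scale_ge_coding[OF f \<open>compact E\<close> \<open>0 < Q\<close> p, of "\<lambda>s. (f ^^ (p - j)) (z s)"])
    show "(f ^^ (p - j)) (z s) \<in> E" if "\<And>k. s k < Q" for s using zE that by blast
    fix s s' u x k
    assume s: "\<And>k. s k < Q" and s': "\<And>k. s' k < Q"
      and ball: "(f ^^ (p - j)) (z s) \<in> bowen_ball f u x r" "(f ^^ (p - j)) (z s') \<in> bowen_ball f u x r"
      and k: "k < u div p"
    \<comment> \<open>The time at which \<open>s k\<close> is visible along the shifted orbit. It is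
      below u for every \<open>k < u div p\<close>, so a Bowen ball of order u determines that many
      symbols.\<close>
    define i where "i = p * k + j"
    have "i < p * Suc k" using j by (simp add: i_def)
    also have "\<dots> \<le> p * (u div p)" using k by (intro mult_le_mono2) simp
    also have "\<dots> \<le> u" by simp
    finally have i: "i < u" .
    have ip: "i + (p - j) = p * Suc k" using j by (simp add: i_def)
    have "dist ((f ^^ i) x) ((f ^^ (p * Suc k)) (z s)) < r"
      "dist ((f ^^ i) x) ((f ^^ (p * Suc k)) (z s')) < r"
      using ball i unfolding bowen_ball_def mem_Collect_eq shift ip[symmetric] by blast+
    then have "dist ((f ^^ (p * Suc k)) (z s)) ((f ^^ (p * Suc k)) (z s')) < 2 * r"
      using dist_triangle3[of "(f ^^ (p * Suc k)) (z s)" "(f ^^ (p * Suc k)) (z s')" "(f ^^ i) x"]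
      by linarith
    moreover have "(f ^^ (p * Suc k)) (z s) \<in> K (2 * s k + P (Suc k))"
      "(f ^^ (p * Suc k)) (z s') \<in> K (2 * s' k + P (Suc k))"
      using z[of s "Suc k", OF s] z[of s' "Suc k", OF s'] by (simp_all add: \<sigma>_def)
    ultimately have "2 * s k + P (Suc k) = 2 * s' k + P (Suc k)"
      using r(2) PN[OF s] PN[OF s'] by blast
    then show "s k = s' k" by simp
  qed
  also have "\<dots> \<le> entropy_at_scale (non_orthogonal \<theta> f) r f"
    by (rule entropy_at_scale_mono) fact
  also have "\<dots> \<le> htop f (non_orthogonal \<theta> f)" by (rule entropy_at_scale_le_htop) fact
  finally show "ereal (ln (real Q) / real p) \<le> htop f (non_orthogonal \<theta> f)" .
  show "non_orthogonal \<theta> f \<noteq> {}"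
    using zE[of "\<lambda>_. 0"] \<open>0 < Q\<close> \<open>E \<subseteq> _\<close> by auto
qed

end

section \<open>Residual sets\<close>

lemma dist_C0_le:
  assumes "\<And>x. dist (f x) (g x) \<le> e"
  shows "dist_C0 f g \<le> e"
  unfolding dist_C0_def by (rule cSUP_least) (use assms in auto)

lemma dist_homeo_le:
  assumes "\<And>x. dist (f x) (g x) \<le> e" "\<And>x. dist (inv f x) (inv g x) \<le> e"
  shows "dist_homeo f g \<le> e"
  unfolding dist_homeo_def using dist_C0_le assms by (metis max.bounded_iff)

text \<open>Uniform continuity of f absorbs the error accumulated over n steps, and the last step of
  g adds the other half; g itself may be discontinuous.\<close>

lemma funpow_uniformly_close:
  fixes f :: "'m::metric_space \<Rightarrow> 'm"
  assumes "compact (UNIV :: 'm set)" "continuous_on UNIV f" "0 < e"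
  shows "\<exists>d>0. \<forall>g. (\<forall>x. dist (f x) (g x) < d) \<longrightarrow> (\<forall>x. dist ((f ^^ n) x) ((g ^^ n) x) < e)"
  using assms(3)
proof (induction n arbitrary: e)
  case 0
  then show ?case by (auto intro: exI[of _ 1])
next
  case (Suc n)
  have "uniformly_continuous_on UNIV f" by (rule compact_uniformly_continuous) fact+
  then obtain d1 where d1: "0 < d1" "\<And>x y. dist x y < d1 \<Longrightarrow> dist (f x) (f y) < e / 2"
    using \<open>0 < e\<close> unfolding uniformly_continuous_on_def
    by (metis UNIV_I dist_commute half_gt_zero)
  obtain d2 where d2: "0 < d2"
    "\<And>g. (\<forall>x. dist (f x) (g x) < d2) \<Longrightarrow> (\<forall>x. dist ((f ^^ n) x) ((g ^^ n) x) < d1)"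
    using Suc.IH[OF d1(1)] by blast
  show ?case
  proof (intro exI[of _ "min d2 (e / 2)"] conjI allI impI)
    fix g x assume g: "\<forall>x. dist (f x) (g x) < min d2 (e / 2)"
    have "dist (f ((f ^^ n) x)) (f ((g ^^ n) x)) < e / 2"
      by (rule d1(2)) (use d2(2)[of g] g in auto)
    moreover have "dist (f ((g ^^ n) x)) (g ((g ^^ n) x)) < e / 2" using g by auto
    ultimately show "dist ((f ^^ Suc n) x) ((g ^^ Suc n) x) < e"
      using dist_triangle[of "f ((f ^^ n) x)" "g ((g ^^ n) x)" "f ((g ^^ n) x)"] by simp
  qed (use d2(1) Suc.prems in auto)
qed

lemma funpow_image_subset_stable:
  fixes f :: "'m::metric_space \<Rightarrow> 'm"
  assumes M: "compact (UNIV :: 'm set)" and f: "continuous_on UNIV f"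
    and "compact C" "open G" "(f ^^ n) ` C \<subseteq> G"
  shows "\<exists>d>0. \<forall>g. (\<forall>x. dist (f x) (g x) < d) \<longrightarrow> (g ^^ n) ` C \<subseteq> G"
proof -
  have "compact ((f ^^ n) ` C)"
    by (intro compact_continuous_image continuous_on_funpow f) fact
  then obtain e where e: "0 < e" "(\<Union>x\<in>(f ^^ n) ` C. ball x e) \<subseteq> G"
    using compact_subset_open_imp_ball_epsilon_subset assms(4,5) by metis
  obtain d where "0 < d"
    "\<And>g. (\<forall>x. dist (f x) (g x) < d) \<Longrightarrow> (\<forall>x. dist ((f ^^ n) x) ((g ^^ n) x) < e)"
    using funpow_uniformly_close[OF M f e(1)] by blast
  then show ?thesis using e(2) by (intro exI[of _ d]) fastforce
qed

lemma common_closeness: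
  fixes f :: "'a \<Rightarrow> 'm::metric_space"
  assumes "finite I" "\<And>i. i \<in> I \<Longrightarrow> \<exists>d>0. \<forall>g. (\<forall>x. dist (f x) (g x) < d) \<longrightarrow> Q i g"
  shows "\<exists>d>0. \<forall>i\<in>I. \<forall>g. (\<forall>x. dist (f x) (g x) < d) \<longrightarrow> Q i g"
  using assms
proof (induction I rule: finite_induct)
  case empty
  then show ?case by (auto intro: exI[of _ 1])
next
  case (insert i I)
  then obtain d where d: "0 < d" "\<forall>i\<in>I. \<forall>g. (\<forall>x. dist (f x) (g x) < d) \<longrightarrow> Q i g" by auto
  obtain d' where d': "0 < d'" "\<forall>g. (\<forall>x. dist (f x) (g x) < d') \<longrightarrow> Q i g"
    using insert.prems by blast
  show ?case using d d' by (intro exI[of _ "min d d'"]) auto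
qed

text \<open>All clauses on \<open>f\<close> have the form \<open>f\<^sup>n(C) \<subseteq> G\<close> with \<open>C\<close> compact and \<open>G\<close> open.\<close>

lemma horseshoe_stable:
  fixes f :: "'m::metric_space \<Rightarrow> 'm"
  assumes M: "compact (UNIV :: 'm set)" and f: "continuous_on UNIV f"
    and hs: "horseshoe f p N V W u \<gamma>"
  shows "\<exists>d>0. \<forall>g. (\<forall>x. dist (f x) (g x) < d) \<longrightarrow> horseshoe g p N V W u \<gamma>"
proof -
  interpret horseshoe f p N V W u \<gamma> by (rule hs)
  have uV: "continuous_on V u" and uW: "continuous_on W u"
    using u by (auto intro: continuous_on_subset)
  have cC: "compact (V \<inter> u -` T)" if "closed T" for T
  proof -
    have "closed (V \<inter> u -` T)"
      by (intro continuous_closed_preimage uV compact_imp_closed V that)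
    then have "compact (V \<inter> (V \<inter> u -` T))" by (rule compact_Int_closed[OF V])
    then show ?thesis by (simp add: Int_absorb)
  qed
  \<comment> \<open>As u is continuous only on \<open>V \<union> W\<close>, preimages of open sets
    are known to be open only inside W. The images of the faces do lie in W, by
    \<open>slab\<close>.\<close>
  have oG: "open (W \<inter> u -` T)" if "open T" for T
    by (rule continuous_open_preimage[OF uW W that])
  have inW: "(f ^^ p) z \<in> W" if "i < N" "z \<in> V" "u z \<in> {2 * real i..2 * real i + 1}" for i z
    using slab that by auto
  have "\<exists>d>0. \<forall>i\<in>{..<N}. \<forall>g. (\<forall>x. dist (f x) (g x) < d) \<longrightarrow>
     (g ^^ p) ` (V \<inter> u -` {2 * real i..2 * real i + 1}) \<subseteq> W"
    by (rule common_closeness[OF finite_lessThan])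
      (intro funpow_image_subset_stable[OF M f cC W]; auto intro: inW)
  then obtain d1 where d1: "d1 > 0" "\<forall>i\<in>{..<N}. \<forall>g. (\<forall>x. dist (f x) (g x) < d1) \<longrightarrow>
     (g ^^ p) ` (V \<inter> u -` {2 * real i..2 * real i + 1}) \<subseteq> W"
    by blast
  have "\<exists>d>0. \<forall>i\<in>{..<N}. \<forall>g. (\<forall>x. dist (f x) (g x) < d) \<longrightarrow>
     (g ^^ p) ` (V \<inter> u -` {2 * real i}) \<subseteq> W \<inter> u -` {..<0}"
    by (rule common_closeness[OF finite_lessThan])
      (intro funpow_image_subset_stable[OF M f cC oG]; auto intro: inW left)
  then obtain d2 where d2: "d2 > 0" "\<forall>i\<in>{..<N}. \<forall>g. (\<forall>x. dist (f x) (g x) < d2) \<longrightarrow>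
     (g ^^ p) ` (V \<inter> u -` {2 * real i}) \<subseteq> W \<inter> u -` {..<0}"
    by blast
  have "\<exists>d>0. \<forall>i\<in>{..<N}. \<forall>g. (\<forall>x. dist (f x) (g x) < d) \<longrightarrow>
     (g ^^ p) ` (V \<inter> u -` {2 * real i + 1}) \<subseteq> W \<inter> u -` {2 * real N<..}"
    by (rule common_closeness[OF finite_lessThan])
      (intro funpow_image_subset_stable[OF M f cC oG]; use right in \<open>auto intro: inW\<close>)
  then obtain d3 where d3: "d3 > 0" "\<forall>i\<in>{..<N}. \<forall>g. (\<forall>x. dist (f x) (g x) < d3) \<longrightarrow>
     (g ^^ p) ` (V \<inter> u -` {2 * real i + 1}) \<subseteq> W \<inter> u -` {2 * real N<..}"
    by blast
  have "\<exists>d>0. \<forall>l\<in>{0<..<p}. \<forall>g. (\<forall>x. dist (f x) (g x) < d) \<longrightarrow>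
     (g ^^ l) ` V \<subseteq> - V"
    by (rule common_closeness[OF finite_greaterThanLessThan])
      (intro funpow_image_subset_stable[OF M f V]; use away compact_imp_closed[OF V] in \<open>auto simp: open_Compl\<close>)
  then obtain d4 where d4: "d4 > 0" "\<forall>l\<in>{0<..<p}. \<forall>g. (\<forall>x. dist (f x) (g x) < d4) \<longrightarrow>
     (g ^^ l) ` V \<subseteq> - V"
    by blast
  define d where "d = min (min d1 d2) (min d3 d4)"
  have "horseshoe g p N V W u \<gamma>" if g: "\<forall>x. dist (f x) (g x) < d" for g
  proof
    have g': "\<forall>x. dist (f x) (g x) < d1" "\<forall>x. dist (f x) (g x) < d2"
      "\<forall>x. dist (f x) (g x) < d3" "\<forall>x. dist (f x) (g x) < d4"
      using g by (simp_all add: d_def)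
    fix i z assume i: "i < N" and z: "z \<in> V"
    show "(g ^^ p) z \<in> W" if "2 * real i \<le> u z" "u z \<le> 2 * real i + 1"
      using d1(2)[rule_format, of i g] g'(1) i z that by (auto simp: image_subset_iff)
    show "u ((g ^^ p) z) < 0" if "u z = 2 * real i"
      using d2(2)[rule_format, of i g] g'(2) i z that by (auto simp: image_subset_iff)
    show "real (2 * N) < u ((g ^^ p) z)" if "u z = 2 * real i + 1"
      using d3(2)[rule_format, of i g] g'(3) i z that by (auto simp: image_subset_iff)
  next
    fix l z assume "0 < l" "l < p" "z \<in> V"
    then show "(g ^^ l) z \<notin> V"
      using d4(2)[rule_format, of l g] g by (auto simp: d_def image_subset_iff)
  qed (use p V W u strip \<gamma> in auto)
  then show ?thesis using d1(1) d2(1) d3(1) d4(1) by (intro exI[of _ d]) (auto simp: d_def)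
qed

section \<open>Completeness of the two spaces of maps\<close>

lemma uniformly_Cauchy_limit:
  fixes \<sigma> :: "nat \<Rightarrow> 'm::metric_space \<Rightarrow> 'm"
  assumes M: "compact (UNIV :: 'm set)" and cont: "\<And>n. continuous_on UNIV (\<sigma> n)"
    and cau: "\<And>e. 0 < e \<Longrightarrow> \<exists>N. \<forall>n n'. N \<le> n \<longrightarrow> N \<le> n' \<longrightarrow> dist_C0 (\<sigma> n) (\<sigma> n') < e"
  shows "\<exists>g. continuous_on UNIV g \<and> (\<forall>e>0. \<exists>N. \<forall>n\<ge>N. dist_C0 (\<sigma> n) g < e)"
proof -
  note up = dist_C0_upper[OF M]
  have "\<exists>l. (\<lambda>n. \<sigma> n x) \<longlonglongrightarrow> l" for x
  proof -
    have "Cauchy (\<lambda>n. \<sigma> n x)"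
    proof (rule metric_CauchyI)
      fix e :: real assume "0 < e"
      then obtain N where "\<forall>n n'. N \<le> n \<longrightarrow> N \<le> n' \<longrightarrow> dist_C0 (\<sigma> n) (\<sigma> n') < e" using cau by blast
      then show "\<exists>N. \<forall>n\<ge>N. \<forall>n'\<ge>N. dist (\<sigma> n x) (\<sigma> n' x) < e"
        using le_less_trans[OF up] by blast
    qed
    then show ?thesis using compact_imp_complete[OF M] by (auto simp: complete_def)
  qed
  then have "\<forall>x. \<exists>l. (\<lambda>n. \<sigma> n x) \<longlonglongrightarrow> l" by blast
  then obtain g where g: "\<And>x. (\<lambda>n. \<sigma> n x) \<longlonglongrightarrow> g x" unfolding choice_iff by blast
  have lim: "\<exists>N. \<forall>n\<ge>N. dist_C0 (\<sigma> n) g < e" if e: "0 < e" for e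
  proof -
    obtain N where N: "\<forall>n n'. N \<le> n \<longrightarrow> N \<le> n' \<longrightarrow> dist_C0 (\<sigma> n) (\<sigma> n') < e / 2"
      using cau[OF half_gt_zero[OF e]] by blast
    have le: "dist_C0 (\<sigma> n) g \<le> e / 2" if n: "N \<le> n" for n
    proof (rule dist_C0_le)
      fix x
      show "dist (\<sigma> n x) (g x) \<le> e / 2"
      proof (rule LIMSEQ_le_const2)
        show "(\<lambda>m. dist (\<sigma> n x) (\<sigma> m x)) \<longlonglongrightarrow> dist (\<sigma> n x) (g x)"
          by (intro tendsto_intros g)
        show "\<exists>N. \<forall>m\<ge>N. dist (\<sigma> n x) (\<sigma> m x) \<le> e / 2"
        proof (intro exI[of _ N] allI impI)
          fix m assume "N \<le> m"
          then have "dist_C0 (\<sigma> n) (\<sigma> m) < e / 2" using N n by blast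
          then show "dist (\<sigma> n x) (\<sigma> m x) \<le> e / 2" using up[of "\<sigma> n" x "\<sigma> m"] by linarith
        qed
      qed
    qed
    have "dist_C0 (\<sigma> n) g < e" if "N \<le> n" for n
      using le[OF that] e by simp
    then show ?thesis by blast
  qed
  have "uniform_limit UNIV \<sigma> g sequentially"
    unfolding uniform_limit_sequentially_iff
  proof (intro allI impI)
    fix e :: real assume "0 < e"
    then obtain N where "\<forall>n\<ge>N. dist_C0 (\<sigma> n) g < e" using lim by blast
    then show "\<exists>N. \<forall>n\<ge>N. \<forall>x\<in>UNIV. dist (\<sigma> n x) (g x) < e"
      using le_less_trans[OF up] by blast
  qed
  then have "continuous_on UNIV g"
    by (rule uniform_limit_theorem[rotated]) (simp_all add: cont)
  with lim show ?thesis by blast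
qed

lemma mcomplete_C0:
  assumes M: "compact (UNIV :: 'm::metric_space set)"
  shows "Metric_space.mcomplete (C0_maps :: ('m \<Rightarrow> 'm) set) dist_C0"
proof -
  interpret Metric_space "C0_maps :: ('m \<Rightarrow> 'm) set" dist_C0 by (rule Metric_space_dist_C0[OF M])
  show ?thesis
    unfolding mcomplete_def
  proof (intro allI impI)
    fix \<sigma> :: "nat \<Rightarrow> 'm \<Rightarrow> 'm" assume \<sigma>: "MCauchy \<sigma>"
    then have in_C0: "\<sigma> n \<in> C0_maps" for n by (auto simp: MCauchy_def)
    then have c: "continuous_on UNIV (\<sigma> n)" for n by (simp add: C0_maps_def)
    have "\<exists>N. \<forall>n n'. N \<le> n \<longrightarrow> N \<le> n' \<longrightarrow> dist_C0 (\<sigma> n) (\<sigma> n') < e" if "0 < e" for e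
      using \<sigma> that unfolding MCauchy_def by blast
    from uniformly_Cauchy_limit[OF M c this]
    obtain g where g: "continuous_on UNIV g" "\<forall>e>0. \<exists>N. \<forall>n\<ge>N. dist_C0 (\<sigma> n) g < e" by blast
    then have "limitin mtopology \<sigma> g sequentially"
      unfolding limit_metric_sequentially by (simp add: in_C0) (simp add: C0_maps_def)
    then show "\<exists>g. limitin mtopology \<sigma> g sequentially" by (rule exI[of _ g])
  qed
qed

lemma homeosI:
  assumes "continuous_on UNIV f" "continuous_on UNIV g" "\<And>x. f (g x) = x" "\<And>x. g (f x) = x"
  shows "f \<in> homeos" "inv f = g"
proof -
  show "inv f = g" using assms(3,4) by (metis inv_unique_comp comp_def ext id_apply)
  moreover have "range f = UNIV" "range g = UNIV" using assms(3,4) by (metis surjI)+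
  ultimately show "f \<in> homeos" using assms by (simp add: homeos_def homeomorphism_def)
qed

lemma homeosD:
  assumes "f \<in> homeos"
  shows "continuous_on UNIV f" "continuous_on UNIV (inv f)" "f (inv f x) = x" "inv f (f x) = x"
  using assms by (auto simp: homeos_def homeomorphism_def)

text \<open>The metric controls the inverses too, so they converge uniformly as well; the identities
  between \<open>\<sigma> n\<close> and its inverse pass to the limit and make the two limit maps
  mutually inverse.\<close>

lemma mcomplete_homeo:
  assumes M: "compact (UNIV :: 'm::metric_space set)"
  shows "Metric_space.mcomplete (homeos :: ('m \<Rightarrow> 'm) set) dist_homeo"
proof -
  interpret Metric_space "homeos :: ('m \<Rightarrow> 'm) set" dist_homeo by (rule Metric_space_dist_homeo[OF M])
  note up = dist_C0_upper[OF M]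
  show ?thesis
    unfolding mcomplete_def
  proof (intro allI impI)
    fix \<sigma> :: "nat \<Rightarrow> 'm \<Rightarrow> 'm" assume \<sigma>: "MCauchy \<sigma>"
    then have hom: "\<sigma> n \<in> homeos" for n by (auto simp: MCauchy_def)
    have cau: "\<exists>N. \<forall>n n'. N \<le> n \<longrightarrow> N \<le> n' \<longrightarrow> dist_C0 (\<sigma> n) (\<sigma> n') < e"
      "\<exists>N. \<forall>n n'. N \<le> n \<longrightarrow> N \<le> n' \<longrightarrow> dist_C0 (inv (\<sigma> n)) (inv (\<sigma> n')) < e" if e: "0 < e" for e
    proof -
      obtain N where N: "\<forall>n n'. N \<le> n \<longrightarrow> N \<le> n' \<longrightarrow> dist_homeo (\<sigma> n) (\<sigma> n') < e"
        using \<sigma> e unfolding MCauchy_def by blast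
      show "\<exists>N. \<forall>n n'. N \<le> n \<longrightarrow> N \<le> n' \<longrightarrow> dist_C0 (\<sigma> n) (\<sigma> n') < e"
        using N unfolding dist_homeo_def by (intro exI[of _ N]) simp
      show "\<exists>N. \<forall>n n'. N \<le> n \<longrightarrow> N \<le> n' \<longrightarrow> dist_C0 (inv (\<sigma> n)) (inv (\<sigma> n')) < e"
        using N unfolding dist_homeo_def by (intro exI[of _ N]) simp
    qed
    have "\<exists>g. continuous_on UNIV g \<and> (\<forall>e>0. \<exists>N. \<forall>n\<ge>N. dist_C0 (\<sigma> n) g < e)"
      by (rule uniformly_Cauchy_limit[OF M homeosD(1)[OF hom] cau(1)])
    then obtain g where g: "continuous_on UNIV g" "\<And>e. 0 < e \<Longrightarrow> \<exists>N. \<forall>n\<ge>N. dist_C0 (\<sigma> n) g < e"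
      by blast
    have "\<exists>h. continuous_on UNIV h \<and> (\<forall>e>0. \<exists>N. \<forall>n\<ge>N. dist_C0 (inv (\<sigma> n)) h < e)"
      by (rule uniformly_Cauchy_limit[OF M homeosD(2)[OF hom] cau(2)])
    then obtain h where h: "continuous_on UNIV h" "\<And>e. 0 < e \<Longrightarrow> \<exists>N. \<forall>n\<ge>N. dist_C0 (inv (\<sigma> n)) h < e"
      by blast
    have inverse: "b (a x) = x"
      if b: "continuous_on UNIV b" and s: "\<And>n x. t n (s n x) = (x :: 'm)"
        and lim_s: "\<And>e. 0 < e \<Longrightarrow> \<exists>N. \<forall>n\<ge>N. dist_C0 (s n) a < e"
        and lim_t: "\<And>e. 0 < e \<Longrightarrow> \<exists>N. \<forall>n\<ge>N. dist_C0 (t n) b < e"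
      for a b :: "'m \<Rightarrow> 'm" and s t :: "nat \<Rightarrow> 'm \<Rightarrow> 'm" and x
    proof -
      have "(\<lambda>n. s n x) \<longlonglongrightarrow> a x"
        unfolding lim_sequentially
      proof (intro allI impI)
        fix e :: real assume "0 < e"
        then obtain N where "\<forall>n\<ge>N. dist_C0 (s n) a < e" using lim_s by blast
        then show "\<exists>N. \<forall>n\<ge>N. dist (s n x) (a x) < e"
          by (intro exI[of _ N]) (auto intro: le_less_trans[OF up])
      qed
      then have "(\<lambda>n. b (s n x)) \<longlonglongrightarrow> b (a x)"
        by (rule continuous_on_tendsto_compose[OF b]) auto
      moreover have "(\<lambda>n. b (s n x)) \<longlonglongrightarrow> x"
        unfolding lim_sequentially
      proof (intro allI impI)
        fix e :: real assume "0 < e"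
        then obtain N where "\<forall>n\<ge>N. dist_C0 (t n) b < e" using lim_t by blast
        moreover have "dist (b (s n x)) x \<le> dist_C0 (t n) b" for n
          using up[of "t n" "s n x" b] by (simp add: s dist_commute)
        ultimately show "\<exists>N. \<forall>n\<ge>N. dist (b (s n x)) x < e"
          by (intro exI[of _ N]) (auto intro: le_less_trans)
      qed
      ultimately show ?thesis by (rule LIMSEQ_unique)
    qed
    have gh: "g (h x) = x" for x
      by (rule inverse[OF g(1) homeosD(3)[OF hom] h(2) g(2)])
    have hg: "h (g x) = x" for x
      by (rule inverse[OF h(1) homeosD(4)[OF hom] g(2) h(2)])
    note hg = homeosI[OF g(1) h(1) gh hg]
    have "\<exists>N. \<forall>n\<ge>N. dist_homeo (\<sigma> n) g < e" if e: "0 < e" for e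
    proof -
      obtain N1 N2 where "\<forall>n\<ge>N1. dist_C0 (\<sigma> n) g < e" "\<forall>n\<ge>N2. dist_C0 (inv (\<sigma> n)) h < e"
        using g(2)[OF e] h(2)[OF e] by blast
      then show ?thesis by (intro exI[of _ "max N1 N2"]) (auto simp: dist_homeo_def hg)
    qed
    then have "limitin mtopology \<sigma> g sequentially"
      unfolding limit_metric_sequentially by (simp add: hom hg(1))
    then show "\<exists>g. limitin mtopology \<sigma> g sequentially" by (rule exI[of _ g])
  qed
qed

definition rich :: "('m::metric_space \<Rightarrow> 'm) \<Rightarrow> nat \<Rightarrow> bool" where
  "rich f k \<longleftrightarrow> (\<exists>p Q V W u \<gamma>. 0 < Q \<and> real k \<le> ln (real Q) / real p \<and> horseshoe f p (2 * Q) V W u \<gamma>)"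

lemma rich_stable:
  fixes f :: "'m::metric_space \<Rightarrow> 'm"
  assumes "compact (UNIV :: 'm set)" "continuous_on UNIV f" "rich f k"
  shows "\<exists>d>0. \<forall>g. (\<forall>x. dist (f x) (g x) < d) \<longrightarrow> rich g k"
proof -
  obtain p Q V W u \<gamma> where Q: "0 < Q" "real k \<le> ln (real Q) / real p"
    and hs: "horseshoe f p (2 * Q) V W u \<gamma>"
    using assms(3) by (auto simp: rich_def)
  obtain d where "0 < d" "\<forall>g. (\<forall>x. dist (f x) (g x) < d) \<longrightarrow> horseshoe g p (2 * Q) V W u \<gamma>"
    using horseshoe_stable[OF assms(1,2) hs] by blast
  with Q show ?thesis unfolding rich_def by blast
qed

lemma rich_non_orthogonal:
  fixes f :: "'m::metric_space \<Rightarrow> 'm"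
  assumes "compact (UNIV :: 'm set)" "continuous_on UNIV f" "rich f k" "nontrivial_weight \<theta>"
  shows "ereal k \<le> htop f (non_orthogonal \<theta> f)" "non_orthogonal \<theta> f \<noteq> {}"
proof -
  obtain p Q V W u \<gamma> where Q: "0 < Q" "real k \<le> ln (real Q) / real p"
    and hs: "horseshoe f p (2 * Q) V W u \<gamma>"
    using assms(3) by (auto simp: rich_def)
  interpret continuous_horseshoe f p "2 * Q" V W u \<gamma>
    using hs assms(1,2) by (simp add: continuous_horseshoe_def continuous_horseshoe_axioms_def)
  have "ereal k \<le> ereal (ln (real Q) / real p)" using Q by simp
  also have "\<dots> \<le> htop f (non_orthogonal \<theta> f)" by (rule htop_non_orthogonal_ge) (use assms Q in auto)
  finally show "ereal k \<le> htop f (non_orthogonal \<theta> f)" .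
  show "non_orthogonal \<theta> f \<noteq> {}" by (rule htop_non_orthogonal_ge) (use assms Q in auto)
qed

lemma all_rich_htop:
  fixes f :: "'m::metric_space \<Rightarrow> 'm"
  assumes M: "compact (UNIV :: 'm set)" and f: "continuous_on UNIV f" and rich: "\<And>k. rich f k"
    and \<theta>: "nontrivial_weight \<theta>"
  shows "htop f (non_orthogonal \<theta> f) = \<infinity>" "htop f UNIV = \<infinity>"
proof -
  show inf: "htop f (non_orthogonal \<theta> f) = \<infinity>"
  proof (rule ereal_top)
    fix B :: real
    obtain k :: nat where "B \<le> k" using real_arch_simple by blast
    then have "ereal B \<le> ereal k" by simp
    also have "\<dots> \<le> htop f (non_orthogonal \<theta> f)" by (rule rich_non_orthogonal(1)[OF M f rich \<theta>])
    finally show "ereal B \<le> htop f (non_orthogonal \<theta> f)" .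
  qed
  then show "htop f UNIV = \<infinity>" using htop_mono[of "non_orthogonal \<theta> f" UNIV f] by simp
qed

text \<open>One Baire argument for both spaces: as d dominates \<open>dist_C0\<close>, small d-balls
  are uniformly small, so each richness level is open in the topology of d.\<close>

lemma residual_rich:
  fixes S :: "('m::metric_space \<Rightarrow> 'm) set"
  assumes M: "compact (UNIV :: 'm set)" and "Metric_space S d" "Metric_space.mcomplete S d"
    and S: "\<And>f. f \<in> S \<Longrightarrow> continuous_on UNIV f" and d: "\<And>f g. dist_C0 f g \<le> d f g"
    and dense: "\<And>f e k. f \<in> S \<Longrightarrow> 0 < e \<Longrightarrow> \<exists>g\<in>S. d f g < e \<and> rich g k"
  shows "residual_in (Metric_space.mtopology S d) {f\<in>S. \<forall>k. rich f k}"
proof -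
  interpret Metric_space S d by fact
  define U where "U k = {f\<in>S. rich f k}" for k
  have "openin mtopology (U k)" for k
    unfolding openin_mtopology
  proof (intro conjI allI impI)
    fix f assume f: "f \<in> U k"
    then have f': "f \<in> S" "rich f k" by (simp_all add: U_def)
    obtain r where r: "0 < r" "\<forall>g. (\<forall>x. dist (f x) (g x) < r) \<longrightarrow> rich g k"
      using rich_stable[OF M S[OF f'(1)] f'(2)] by blast
    have "mball f r \<subseteq> U k"
    proof
      fix g assume g: "g \<in> mball f r"
      then have "dist (f x) (g x) < r" for x
        using dist_C0_upper[OF M, of f x g] d[of f g] by (auto intro: le_less_trans)
      with r(2) g show "g \<in> U k" by (auto simp: U_def)
    qed
    with r(1) show "\<exists>r>0. mball f r \<subseteq> U k" by blast
  qed (auto simp: U_def)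
  note ope = this
  have "mtopology closure_of (U k) = S" for k
  proof
    show "mtopology closure_of U k \<subseteq> S" by (metis closure_of_subset_topspace topspace_mtopology)
    show "S \<subseteq> mtopology closure_of U k"
    proof
      fix f assume f: "f \<in> S"
      have "\<exists>g\<in>U k. g \<in> mball f r" if r: "0 < r" for r
        using dense[OF f r, of k] f by (auto simp: U_def)
      with f show "f \<in> mtopology closure_of U k" by (simp add: metric_closure_of)
    qed
  qed
  then have "mtopology closure_of \<Inter>(range U) = S"
    using ope by (intro metric_Baire_category assms(3)) auto
  moreover have "gdelta_in mtopology (\<Inter>(range U))"
    by (intro gdelta_in_Inter) (auto intro: open_imp_gdelta_in ope)
  moreover have "\<Inter>(range U) = {f\<in>S. \<forall>k. rich f k}" by (auto simp: U_def)
  ultimately show ?thesis unfolding residual_in_def by auto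
qed

section \<open>Perturbation in charts\<close>

lemma chart_ball:
  fixes A :: "('m::metric_space, 'e::euclidean_space) chart set" and y :: 'm
  assumes A: "smooth_atlas A" and e: "0 < e"
  shows "\<exists>W c d. open W \<and> y \<in> W \<and> homeomorphism W (ball (0::'e) 1) c d \<and> c y = 0 \<and> (\<forall>z\<in>W. dist y z < e)"
proof -
  have "y \<in> (\<Union>c\<in>A. fst c)" using A by (simp add: smooth_atlas_def)
  then obtain a where a: "a \<in> A" "y \<in> fst a" by blast
  define U where "U = fst a"
  define \<phi> where "\<phi> = snd a"
  define \<psi> where "\<psi> = inv_into U \<phi>"
  have "is_chart a" using A a(1) by (simp add: smooth_atlas_def)
  then have U: "open U" "open (\<phi> ` U)" and hom: "homeomorphism U (\<phi> ` U) \<phi> \<psi>"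
    by (auto simp: is_chart_def U_def \<phi>_def \<psi>_def)
  have yU: "y \<in> U" using a(2) by (simp add: U_def)
  have "openin (top_of_set U) (U \<inter> ball y e)" by (rule openin_open_Int) simp
  then have "openin (top_of_set (\<phi> ` U)) (\<phi> ` (U \<inter> ball y e))"
    by (rule homeomorphism_imp_open_map[OF hom])
  then have "open (\<phi> ` (U \<inter> ball y e))" using U(2) by (simp add: openin_open_eq)
  moreover have "\<phi> y \<in> \<phi> ` (U \<inter> ball y e)" using yU e by auto
  ultimately obtain R where R: "0 < R" "ball (\<phi> y) R \<subseteq> \<phi> ` (U \<inter> ball y e)"
    by (meson open_contains_ball)
  define W where "W = \<psi> ` ball (\<phi> y) R"
  have \<psi>: "\<psi> w \<in> U \<inter> ball y e" "\<phi> (\<psi> w) = w" if w: "w \<in> ball (\<phi> y) R" for w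
  proof -
    obtain z where "z \<in> U \<inter> ball y e" "w = \<phi> z" using R(2) w by auto
    then show "\<psi> w \<in> U \<inter> ball y e" "\<phi> (\<psi> w) = w" using homeomorphism_apply1[OF hom] by auto
  qed
  have sub: "ball (\<phi> y) R \<subseteq> \<phi> ` U" using R(2) by auto
  have "openin (top_of_set (\<phi> ` U)) (ball (\<phi> y) R)" using sub by (simp add: open_subset)
  then have "openin (top_of_set U) W"
    unfolding W_def by (rule homeomorphism_imp_open_map[OF homeomorphism_symD[OF hom]])
  then have W: "open W" using U(1) by (simp add: openin_open_eq)
  have WU: "W \<subseteq> U" using \<psi>(1) by (auto simp: W_def)
  define c where "c z = (1 / R) *\<^sub>R (\<phi> z - \<phi> y)" for z
  define d where "d v = \<psi> (\<phi> y + R *\<^sub>R v)" for v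
  have in_ball: "\<phi> y + R *\<^sub>R v \<in> ball (\<phi> y) R" if "v \<in> ball 0 1" for v
    using that R(1) by (simp add: dist_norm)
  have "homeomorphism W (ball 0 1) c d"
  proof (rule homeomorphismI)
    have "continuous_on W \<phi>" using hom WU by (auto simp: homeomorphism_def intro: continuous_on_subset)
    then show "continuous_on W c" unfolding c_def by (intro continuous_intros)
    have "continuous_on (ball (\<phi> y) R) \<psi>" using hom sub by (auto simp: homeomorphism_def intro: continuous_on_subset)
    then show "continuous_on (ball 0 1) d"
      unfolding d_def by (rule continuous_on_compose2) (use in_ball in \<open>auto intro!: continuous_intros\<close>)
    show "c ` W \<subseteq> ball 0 1"
      using \<psi>(2) R(1) by (auto simp: W_def c_def dist_norm norm_minus_commute)
    show "d ` ball 0 1 \<subseteq> W" using in_ball by (auto simp: W_def d_def)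
    show "d (c z) = z" if z: "z \<in> W" for z
      using z \<psi>(2) R(1) by (auto simp: W_def c_def d_def)
    show "c (d v) = v" if v: "v \<in> ball 0 1" for v
      using \<psi>(2)[OF in_ball[OF v]] R(1) by (simp add: c_def d_def)
  qed
  moreover have "y \<in> W"
    unfolding W_def using homeomorphism_apply1[OF hom yU] R(1) by (metis centre_in_ball imageI)
  moreover have "dist y z < e" if "z \<in> W" for z using that \<psi>(1) by (auto simp: W_def)
  ultimately show ?thesis using W by (intro exI[of _ W] exI[of _ c] exI[of _ d]) (auto simp: c_def)
qed

text \<open>Recurrence is found in a ball around an accumulation point, but the box has to sit
  around the returning point. Changing only the coordinates, not the set W, preserves all return
  conditions.\<close>

lemma chart_recentre:
  fixes c :: "'m::metric_space \<Rightarrow> 'e::euclidean_space"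
  assumes hom: "homeomorphism W (ball 0 1) c d" and x: "x \<in> W"
  shows "\<exists>c' d'. homeomorphism W (ball (0::'e) 1) c' d' \<and> c' x = 0"
proof -
  have cx: "c x \<in> ball 0 1" using homeomorphism_image1[OF hom] x by blast
  have aff: "affine hull (ball (0::'e) 1) = UNIV" by (rule affine_hull_open) auto
  have "openin (top_of_set (affine hull (ball (0::'e) 1))) (ball 0 1)"
    "ball (0::'e) 1 \<subseteq> affine hull (ball 0 1)" "connected (ball (0::'e) 1)" "(0::'e) \<in> ball 0 1"
    by (simp_all add: aff)
  note move = homeomorphism_moving_point[OF this(1) order_refl this(2,3) cx this(4)]
  obtain h k where "homeomorphism (ball (0::'e) 1) (ball (0::'e) 1) h k" "h (c x) = 0"
    by (rule move)
  then show ?thesis using homeomorphism_compose[OF hom] by (intro exI[of _ "h \<circ> c"] exI[of _ "d \<circ> k"]) auto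
qed

text \<open>An arbitrary orbit accumulates somewhere and thus visits a small ball W there
  repeatedly. Taking p as the least gap between any two visits rules out visits strictly in
  between.\<close>

lemma first_return_chart:
  fixes A :: "('m::metric_space, 'e::euclidean_space) chart set" and f :: "'m \<Rightarrow> 'm"
  assumes M: "compact (UNIV :: 'm set)" and A: "smooth_atlas A" and e: "0 < e"
  shows "\<exists>W c d x p. open W \<and> homeomorphism W (ball (0::'e) 1) c d \<and> x \<in> W \<and> c x = 0 \<and>
    0 < p \<and> (f ^^ p) x \<in> W \<and> (\<forall>l. 0 < l \<longrightarrow> l < p \<longrightarrow> (f ^^ l) x \<notin> W) \<and> (\<forall>z\<in>W. \<forall>w\<in>W. dist z w < e)"
proof -
  obtain x0 :: 'm where True by blast
  obtain y r where r: "strict_mono r" "((\<lambda>n. (f ^^ n) x0) \<circ> r) \<longlonglongrightarrow> y"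
    using M unfolding compact_eq_seq_compact_metric seq_compact_def by blast
  obtain W c d where W: "open W" "y \<in> W" and hom: "homeomorphism W (ball (0::'e) 1) c d"
    and diam: "\<forall>z\<in>W. dist y z < e / 2"
    using chart_ball[OF A half_gt_zero[OF e], of y] by blast
  have "\<forall>\<^sub>F n in sequentially. (f ^^ r n) x0 \<in> W"
    using topological_tendstoD[OF r(2) W] by simp
  then obtain n0 where n0: "\<And>n. n0 \<le> n \<Longrightarrow> (f ^^ r n) x0 \<in> W"
    by (auto simp: eventually_sequentially)
  define P where "P q \<longleftrightarrow> 0 < q \<and> (\<exists>m. (f ^^ m) x0 \<in> W \<and> (f ^^ (q + m)) x0 \<in> W)" for q
  have lt: "r n0 < r (Suc n0)" using r(1) by (simp add: strict_mono_def)
  have "P (r (Suc n0) - r n0)"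
    unfolding P_def using n0[of n0] n0[of "Suc n0"] lt by (intro conjI exI[of _ "r n0"]) auto
  then have p: "P (LEAST q. P q)" by (rule LeastI)
  define p where "p = (LEAST q. P q)"
  obtain m where m: "0 < p" "(f ^^ m) x0 \<in> W" "(f ^^ (p + m)) x0 \<in> W"
    using p by (auto simp: P_def p_def)
  define x where "x = (f ^^ m) x0"
  have x: "x \<in> W" "(f ^^ p) x \<in> W" using m by (simp_all add: x_def funpow_add)
  have away: "(f ^^ l) x \<notin> W" if l: "0 < l" "l < p" for l
  proof
    assume "(f ^^ l) x \<in> W"
    then have "P l" using l m(2) by (auto simp: P_def x_def funpow_add intro!: exI[of _ m])
    then show False using not_less_Least l(2) by (auto simp: p_def)
  qed
  obtain c' d' where "homeomorphism W (ball (0::'e) 1) c' d'" "c' x = 0"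
    using chart_recentre[OF hom x(1)] by blast
  moreover have "dist z w < e" if "z \<in> W" "w \<in> W" for z w
    using diam that dist_triangle3[of z w y] by (smt (verit) field_sum_of_halves)
  ultimately show ?thesis using W(1) x away m(1)
    by (intro exI[of _ W] exI[of _ c'] exI[of _ d'] exI[of _ x] exI[of _ p]) simp
qed

text \<open>V is the image of a closed cylinder of half-length r and radius \<delta> around the
  b-axis. \<open>W'\<close> is the open tube of the same radius, so a point of \<open>W'\<close>
  outside V lies beyond an end. The strict inequality in \<open>thin\<close> puts the returning
  images into this open tube.\<close>

lemma chart_horseshoe:
  fixes c :: "'m::metric_space \<Rightarrow> 'e::euclidean_space" and g :: "'m \<Rightarrow> 'm" and r \<delta> :: real and p N :: nat
  defines "Box \<equiv> (\<lambda>b. {v :: 'e. \<bar>v \<bullet> b\<bar> \<le> r \<and> norm (v - (v \<bullet> b) *\<^sub>R b) \<le> \<delta>})"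
  assumes hom: "homeomorphism W (ball 0 1) c d" and W: "open W" and b: "b \<in> Basis"
    and r: "0 < r" "0 < \<delta>" "r + \<delta> < 1" and p: "0 < p" and N: "0 < N"
    and ret: "\<And>v. v \<in> Box b \<Longrightarrow> (g ^^ p) (d v) \<in> W"
    and thin: "\<And>v. v \<in> Box b \<Longrightarrow>
        norm (c ((g ^^ p) (d v)) - (c ((g ^^ p) (d v)) \<bullet> b) *\<^sub>R b) < \<delta>"
    and away: "\<And>v l. v \<in> Box b \<Longrightarrow> 0 < l \<Longrightarrow> l < p \<Longrightarrow> (g ^^ l) (d v) \<notin> d ` Box b"
    and left: "\<And>v i. i < N \<Longrightarrow> v \<in> Box b \<Longrightarrow> v \<bullet> b = (2 * real i - N) * (r / N) \<Longrightarrow>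
        c ((g ^^ p) (d v)) \<bullet> b < - r"
    and right: "\<And>v i. i < N \<Longrightarrow> v \<in> Box b \<Longrightarrow> v \<bullet> b = (2 * real i + 1 - N) * (r / N) \<Longrightarrow>
        r < c ((g ^^ p) (d v)) \<bullet> b"
  shows "\<exists>V W' u \<gamma>. horseshoe g p N V W' u \<gamma>"
proof -
  have bb: "b \<bullet> b = 1" "norm b = 1" using b by (simp_all add: norm_eq_1)
  define B where "B = Box b"
  have B: "v \<in> B \<longleftrightarrow> \<bar>v \<bullet> b\<bar> \<le> r \<and> norm (v - (v \<bullet> b) *\<^sub>R b) \<le> \<delta>" for v by (simp add: B_def Box_def)
  have Bnorm: "norm v \<le> r + \<delta>" if "v \<in> B" for v
  proof -
    have "norm v \<le> norm ((v \<bullet> b) *\<^sub>R b) + norm (v - (v \<bullet> b) *\<^sub>R b)"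
      using norm_triangle_ineq[of "(v \<bullet> b) *\<^sub>R b" "v - (v \<bullet> b) *\<^sub>R b"] by simp
    then show ?thesis using that B bb by (smt (verit) norm_scaleR real_norm_def mult_cancel_left2)
  qed
  have Bsub: "B \<subseteq> ball 0 1" using Bnorm r by force
  have "closed B"
  proof -
    have "B = {v. \<bar>v \<bullet> b\<bar> \<le> r} \<inter> {v. norm (v - (v \<bullet> b) *\<^sub>R b) \<le> \<delta>}" by (auto simp: B)
    then show ?thesis by (auto intro!: closed_Int closed_Collect_le continuous_intros)
  qed
  moreover have "bounded B" using Bnorm by (auto simp: bounded_iff)
  ultimately have cB: "compact B" by (simp add: compact_eq_bounded_closed)
  have dcont: "continuous_on (ball 0 1) d" and ccont: "continuous_on W c" using hom by (simp_all add: homeomorphism_def)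
  have cd: "c (d v) = v" if "v \<in> ball 0 1" for v using homeomorphism_apply2[OF hom that] .
  have dc: "d (c z) = z" if "z \<in> W" for z using homeomorphism_apply1[OF hom that] .
  have dW: "d v \<in> W" if "v \<in> ball 0 1" for v using homeomorphism_image2[OF hom] that by blast
  define V where "V = d ` B"
  define W' where "W' = W \<inter> c -` {v. norm (v - (v \<bullet> b) *\<^sub>R b) < \<delta>}"
  \<comment> \<open>The affine rescaling of \<open>[-r, r]\<close> to \<open>[0, 2N]\<close>; the
    level \<open>u = j\<close> has b-coordinate \<open>(j - N) * (r / N)\<close>, whence the
    positions of the faces.\<close>
  define u where "u z = (c z \<bullet> b) * (N / r) + N" for z
  define \<gamma> where "\<gamma> t = d (((2 * t - 1) * r) *\<^sub>R b)" for t :: real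
  have ud: "u (d v) = (v \<bullet> b) * (N / r) + N" if "v \<in> B" for v using cd that Bsub by (auto simp: u_def)
  have u_eq: "v \<bullet> b = (k - N) * (r / N)" if "v \<in> B" "u (d v) = k" for v k
    using ud[OF that(1)] that(2) r N by (simp add: field_simps)
  have seg: "((2 * t - 1) * r) *\<^sub>R b \<in> B" if "t \<in> {0..1}" for t
  proof -
    have "\<bar>2 * t - 1\<bar> \<le> 1" using that by auto
    then have "\<bar>2 * t - 1\<bar> * r \<le> 1 * r" using r by (intro mult_right_mono) auto
    then show ?thesis using r by (simp add: B bb abs_mult)
  qed
  have "horseshoe g p N V W' u \<gamma>"
  proof
    show "0 < p" by (rule p)
    show "compact V" unfolding V_def
      by (intro compact_continuous_image continuous_on_subset[OF dcont] Bsub cB)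
    show "open W'" unfolding W'_def
      by (intro continuous_open_preimage ccont W open_Collect_less continuous_intros)
    have "V \<union> W' \<subseteq> W" using dW Bsub by (auto simp: V_def W'_def)
    then show "continuous_on (V \<union> W') u"
      unfolding u_def by (intro continuous_intros continuous_on_subset[OF ccont])
    show "z \<in> V" if z: "z \<in> W'" "0 \<le> u z" "u z \<le> real (2 * N)" for z
    proof -
      have "0 \<le> N * (r + c z \<bullet> b)" using z(2) r by (simp add: u_def field_simps)
      then have "- r \<le> c z \<bullet> b" using N by (simp add: zero_le_mult_iff)
      moreover have "c z \<bullet> b \<le> r" using z(3) r N by (simp add: u_def field_simps)
      ultimately have "c z \<in> B" using z(1) by (auto simp: B W'_def)
      then show ?thesis using dc[of z] z(1) by (force simp: V_def W'_def)
    qed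
    show "continuous_on {0..1} \<gamma>"
      unfolding \<gamma>_def
    proof (rule continuous_on_compose2[OF dcont])
      show "continuous_on {0..1} (\<lambda>t. ((2 * t - 1) * r) *\<^sub>R b)" by (intro continuous_intros)
      show "(\<lambda>t. ((2 * t - 1) * r) *\<^sub>R b) ` {0..1} \<subseteq> ball 0 1" using seg Bsub by blast
    qed
    show "\<gamma> ` {0..1} \<subseteq> V" using seg by (auto simp: \<gamma>_def V_def)
    show "u (\<gamma> 0) \<le> 0" "real (2 * N) \<le> u (\<gamma> 1)"
      using ud[OF seg[of 0]] ud[OF seg[of 1]] r by (simp_all add: \<gamma>_def bb)
    fix i z assume i: "i < N" and "z \<in> V"
    then obtain v where v: "v \<in> B" "z = d v" by (auto simp: V_def)
    show "(g ^^ p) z \<in> W'"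
      using ret[of v] thin[of v] v by (auto simp: W'_def B_def)
    show "u ((g ^^ p) z) < 0" if "u z = 2 * real i"
    proof -
      have "c ((g ^^ p) z) \<bullet> b < - r" using left[OF i, of v] u_eq[of v] v that by (auto simp: B_def)
      then have "real N * (r + c ((g ^^ p) z) \<bullet> b) < 0" using N by (intro mult_pos_neg) auto
      then show ?thesis using r by (simp add: u_def field_simps)
    qed
    show "real (2 * N) < u ((g ^^ p) z)" if "u z = 2 * real i + 1"
    proof -
      have "r < c ((g ^^ p) z) \<bullet> b" using right[OF i, of v] u_eq[of v] v that by (auto simp: B_def)
      then have "0 < real N * (c ((g ^^ p) z) \<bullet> b - r)" using N by (intro mult_pos_pos) auto
      then show ?thesis using r by (simp add: u_def field_simps)
    qed
  next
    fix l z assume "0 < l" "l < p" "z \<in> V"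
    then show "(g ^^ l) z \<notin> V" using away by (auto simp: V_def B_def)
  qed
  then show ?thesis by blast
qed

section \<open>Homeomorphisms supported in a chart ball\<close>

lemma extend_homeo_continuous:
  fixes c :: "'m::metric_space \<Rightarrow> 'e::euclidean_space"
  assumes hom: "homeomorphism W (ball 0 1) c d" and W: "open W" and T: "continuous_on UNIV T"
    and "\<rho> < 1" and fixT: "\<And>v. \<rho> \<le> norm v \<Longrightarrow> T v = v" and maps: "\<And>v. v \<in> ball 0 1 \<Longrightarrow> T v \<in> ball 0 1"
  shows "continuous_on UNIV (\<lambda>z. if z \<in> W then d (T (c z)) else z)" (is "continuous_on UNIV ?h")
proof -
  have dcont: "continuous_on (ball 0 1) d" and ccont: "continuous_on W c" using hom by (simp_all add: homeomorphism_def)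
  \<comment> \<open>Off this compact set the map is the identity, so it is continuous on each of the
    two open sets \<open>W\<close> and \<open>- C\<close>, which cover the space.\<close>
  define C where "C = d ` cball 0 \<rho>"
  have "compact C" unfolding C_def
    by (intro compact_continuous_image continuous_on_subset[OF dcont]) (use \<open>\<rho> < 1\<close> in auto)
  then have oC: "open (- C)" by (simp add: compact_imp_closed open_Compl)
  have "T (c z) \<in> ball 0 1" if "z \<in> W" for z
    using homeomorphism_image1[OF hom] that by (intro maps) blast
  then have "continuous_on W (\<lambda>z. d (T (c z)))"
    by (intro continuous_on_compose2[OF dcont] continuous_on_compose2[OF T] ccont) auto
  then have 1: "continuous_on W ?h" by (rule continuous_on_eq) simp
  have "?h z = z" if "z \<in> - C" for z
  proof (cases "z \<in> W")
    case True
    then have z: "d (c z) = z" "c z \<in> ball 0 1"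
      using homeomorphism_apply1[OF hom] homeomorphism_image1[OF hom] by auto
    then have "\<not> norm (c z) \<le> \<rho>" using that by (force simp: C_def)
    then show ?thesis using fixT[of "c z"] z True by simp
  qed simp
  then have 2: "continuous_on (- C) ?h" by (intro continuous_on_eq[OF continuous_on_id]) simp
  have "C \<subseteq> W" using homeomorphism_image2[OF hom] \<open>\<rho> < 1\<close> by (auto simp: C_def)
  then have "W \<union> - C = UNIV" by auto
  with continuous_on_open_Un[OF W oC 1 2] show ?thesis by simp
qed

text \<open>The inverse of T also fixes every point of norm at least \<rho>, so both maps preserve
  the unit ball and extend by the identity.\<close>

lemma extend_homeo:
  fixes c :: "'m::metric_space \<Rightarrow> 'e::euclidean_space"
  assumes hom: "homeomorphism W (ball 0 1) c d" and W: "open W" and T: "homeomorphism UNIV UNIV T T'"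
    and "\<rho> < 1" and fixT: "\<And>v. \<rho> \<le> norm v \<Longrightarrow> T v = v"
  shows "\<exists>\<eta>\<in>homeos. (\<forall>z\<in>W. \<eta> z = d (T (c z)) \<and> \<eta> z \<in> W \<and> c (\<eta> z) = T (c z)) \<and> (\<forall>z. z \<notin> W \<longrightarrow> \<eta> z = z)
    \<and> (\<forall>z\<in>W. inv \<eta> z \<in> W) \<and> (\<forall>z. z \<notin> W \<longrightarrow> inv \<eta> z = z)"
proof -
  have T'T: "T' (T v) = v" and TT': "T (T' v) = v" for v using T by (simp_all add: homeomorphism_def)
  have fixT': "T' v = v" if "\<rho> \<le> norm v" for v using fixT[OF that] T'T by metis
  have maps: "T v \<in> ball 0 1" if "v \<in> ball 0 1" for v
  proof (rule ccontr)
    assume "T v \<notin> ball 0 1"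
    then have "T' (T v) = T v" using \<open>\<rho> < 1\<close> by (intro fixT') auto
    then show False using that T'T \<open>T v \<notin> ball 0 1\<close> by simp
  qed
  have maps': "T' v \<in> ball 0 1" if "v \<in> ball 0 1" for v
  proof (rule ccontr)
    assume "T' v \<notin> ball 0 1"
    then have "T (T' v) = T' v" using \<open>\<rho> < 1\<close> by (intro fixT) auto
    then show False using that TT' \<open>T' v \<notin> ball 0 1\<close> by simp
  qed
  have cW: "c z \<in> ball 0 1" if "z \<in> W" for z using homeomorphism_image1[OF hom] that by blast
  have dW: "d v \<in> W" if "v \<in> ball 0 1" for v using homeomorphism_image2[OF hom] that by blast
  have cd: "c (d v) = v" if "v \<in> ball 0 1" for v using homeomorphism_apply2[OF hom that] .
  have dc: "d (c z) = z" if "z \<in> W" for z using homeomorphism_apply1[OF hom that] .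
  define \<eta> where "\<eta> z = (if z \<in> W then d (T (c z)) else z)" for z
  define \<eta>' where "\<eta>' z = (if z \<in> W then d (T' (c z)) else z)" for z
  have cont: "continuous_on UNIV T" "continuous_on UNIV T'" using T by (simp_all add: homeomorphism_def)
  have \<eta>W: "\<eta> z \<in> W" "c (\<eta> z) = T (c z)" if "z \<in> W" for z
    using that maps[OF cW[OF that]] dW cd by (simp_all add: \<eta>_def)
  have \<eta>'W: "\<eta>' z \<in> W" "c (\<eta>' z) = T' (c z)" if "z \<in> W" for z
    using that maps'[OF cW[OF that]] dW cd by (simp_all add: \<eta>'_def)
  have e: "\<eta> (\<eta>' z) = z" for z
  proof (cases "z \<in> W")
    case True
    then show ?thesis using \<eta>'W[OF True] dc by (simp add: \<eta>_def TT')
  qed (simp add: \<eta>_def \<eta>'_def)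
  have e': "\<eta>' (\<eta> z) = z" for z
  proof (cases "z \<in> W")
    case True
    then show ?thesis using \<eta>W[OF True] dc by (simp add: \<eta>'_def T'T)
  qed (simp add: \<eta>_def \<eta>'_def)
  have "continuous_on UNIV \<eta>" "continuous_on UNIV \<eta>'"
    unfolding \<eta>_def \<eta>'_def
    using extend_homeo_continuous[OF hom W cont(1) \<open>\<rho> < 1\<close> fixT maps]
      extend_homeo_continuous[OF hom W cont(2) \<open>\<rho> < 1\<close> fixT' maps'] by auto
  from homeosI[OF this e e'] have \<eta>: "\<eta> \<in> homeos" "inv \<eta> = \<eta>'" .
  show ?thesis
  proof (rule bexI[OF _ \<eta>(1)], intro conjI ballI allI impI)
    fix z assume z: "z \<in> W"
    show "\<eta> z = d (T (c z))" using z by (simp add: \<eta>_def)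
    show "\<eta> z \<in> W" "c (\<eta> z) = T (c z)" using \<eta>W[OF z] by auto
    show "inv \<eta> z \<in> W" using \<eta>'W(1)[OF z] by (simp add: \<eta>(2))
  next
    fix z assume "z \<notin> W"
    then show "\<eta> z = z" "inv \<eta> z = z" by (simp_all add: \<eta>(2) \<eta>_def \<eta>'_def)
  qed
qed

text \<open>Solving \<open>v - h v = w\<close> is a fixed point problem for the contraction
  \<open>\<lambda>v. w + h v\<close>; distances shrink at most by the factor \<open>1 - k\<close>,
  which gives injectivity and a Lipschitz inverse.\<close>

lemma homeomorphism_near_identity:
  fixes h :: "'e::euclidean_space \<Rightarrow> 'e"
  assumes k: "0 \<le> k" "k < 1" and lip: "\<And>v w. norm (h v - h w) \<le> k * norm (v - w)"
  shows "\<exists>g. homeomorphism UNIV UNIV (\<lambda>v. v - h v) g"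
proof -
  define s where "s v = v - h v" for v
  have expand: "(1 - k) * norm (v - w) \<le> norm (s v - s w)" for v w
  proof -
    have "norm (v - w) \<le> norm (s v - s w) + norm (h v - h w)"
      using norm_triangle_ineq[of "s v - s w" "h v - h w"] by (simp add: s_def algebra_simps)
    with lip[of v w] show ?thesis by (simp add: algebra_simps)
  qed
  have surj: "\<exists>v. s v = w" for w
  proof -
    have "\<exists>!v. w + h v = v"
      by (rule banach_fix_type[OF k]) (use lip in \<open>auto simp: dist_norm\<close>)
    then obtain v where "w + h v = v" by blast
    then show ?thesis by (intro exI[of _ v]) (simp add: s_def algebra_simps)
  qed
  then obtain g where g: "\<And>w. s (g w) = w" by metis
  have inj: "v = w" if "s v = s w" for v w
  proof -
    have "(1 - k) * norm (v - w) \<le> 0" using expand[of v w] that by simp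
    then show ?thesis using k by (simp add: mult_le_0_iff)
  qed
  have gs: "g (s v) = v" for v by (rule inj) (rule g)
  have "continuous_on UNIV h"
    by (rule lipschitz_on_continuous_on[of k]) (use k lip in \<open>auto simp: lipschitz_on_def dist_norm\<close>)
  then have cs: "continuous_on UNIV s" unfolding s_def by (intro continuous_intros)
  have "dist (g v) (g w) \<le> inverse (1 - k) * dist v w" for v w
    using expand[of "g v" "g w"] k by (simp add: g dist_norm field_simps)
  then have cg: "continuous_on UNIV g"
    by (intro lipschitz_on_continuous_on[of "inverse (1 - k)"]) (use k in \<open>auto simp: lipschitz_on_def\<close>)
  have "homeomorphism UNIV UNIV s g"
    using cs cg by (rule homeomorphismI) (auto simp: g gs)
  then show ?thesis unfolding s_def by blast
qed

text \<open>
  The map \<open>v \<mapsto> v - \<kappa>\<lambda>(v)Qv\<close>, where \<open>Q\<close> is the projection orthogonal to \<open>b\<close> and \<open>\<lambda>\<close> a cut-off function,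
  contracts the directions orthogonal to \<open>b\<close> by the factor \<open>1 - \<kappa>\<close> where \<open>\<lambda> = 1\<close>; iterate it.
\<close>

lemma squeeze_homeomorphism:
  fixes b :: "'e::euclidean_space" and \<rho> \<rho>' \<delta> :: real
  assumes b: "b \<in> Basis" and \<rho>: "0 < \<rho>" "\<rho> < \<rho>'" and \<delta>: "0 < \<delta>"
  shows "\<exists>S S'. homeomorphism UNIV UNIV S S' \<and> (\<forall>v. S v \<bullet> b = v \<bullet> b) \<and> (\<forall>v. \<rho>' \<le> norm v \<longrightarrow> S v = v) \<and>
    (\<forall>v. norm v \<le> \<rho> \<longrightarrow> norm (S v - (S v \<bullet> b) *\<^sub>R b) < \<delta>)"
proof -
  have bb: "b \<bullet> b = 1" "norm b = 1" using b by simp_all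
  define Q where "Q v = v - (v \<bullet> b) *\<^sub>R b" for v
  have Q_diff: "Q (v - w) = Q v - Q w" and Q_scale: "Q (t *\<^sub>R v) = t *\<^sub>R Q v" for v w t
    by (simp_all add: Q_def algebra_simps inner_diff_left)
  have Qb: "Q v \<bullet> b = 0" for v by (simp add: Q_def inner_diff_left bb)
  have QQ: "Q (Q v) = Q v" for v using Qb[of v] unfolding Q_def[of "Q v"] by simp
  have Qn: "norm (Q v) \<le> norm v" for v
  proof -
    have "Q v \<bullet> Q v = v \<bullet> v - (v \<bullet> b)\<^sup>2"
      by (simp add: Q_def inner_diff_left inner_diff_right bb inner_commute power2_eq_square)
    then have "(norm (Q v))\<^sup>2 \<le> (norm v)\<^sup>2" by (simp add: power2_norm_eq_inner)
    then show ?thesis by (rule power2_le_imp_le) simp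
  qed
  define l where "l v = max 0 (min 1 ((\<rho>' - norm v) / (\<rho>' - \<rho>)))" for v :: 'e
  have l: "0 \<le> l v" "l v \<le> 1" "norm v \<le> \<rho> \<Longrightarrow> l v = 1" "\<rho>' \<le> norm v \<Longrightarrow> l v = 0" for v
    using \<rho> by (simp_all add: l_def divide_nonpos_pos)
  have l_lip: "\<bar>l v - l w\<bar> \<le> norm (v - w) / (\<rho>' - \<rho>)" for v w
  proof -
    have "\<bar>l v - l w\<bar> \<le> \<bar>(\<rho>' - norm v) / (\<rho>' - \<rho>) - (\<rho>' - norm w) / (\<rho>' - \<rho>)\<bar>"
      unfolding l_def by linarith
    also have "\<dots> = \<bar>norm w - norm v\<bar> / (\<rho>' - \<rho>)"
      using \<rho> by (simp flip: diff_divide_distrib)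
    also have "\<dots> \<le> norm (v - w) / (\<rho>' - \<rho>)"
      using \<rho> norm_triangle_ineq3[of w v] by (intro divide_right_mono) (auto simp: norm_minus_commute)
    finally show ?thesis .
  qed
  define C where "C = \<rho>' / (\<rho>' - \<rho>) + 1"
  have C: "1 \<le> C" using \<rho> by (simp add: C_def)
  \<comment> \<open>In the product estimate \<open>Q v\<close> must be bounded, so one point is
    taken in the ball of radius \<open>\<rho>'\<close>; if both points lie outside, both terms
    vanish.\<close>
  have lip1: "norm (l v *\<^sub>R Q v - l w *\<^sub>R Q w) \<le> C * norm (v - w)" if "norm v \<le> \<rho>'" for v w
  proof -
    have "l v *\<^sub>R Q v - l w *\<^sub>R Q w = (l v - l w) *\<^sub>R Q v + l w *\<^sub>R Q (v - w)"
      by (simp add: Q_diff algebra_simps)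
    then have "norm (l v *\<^sub>R Q v - l w *\<^sub>R Q w) \<le> \<bar>l v - l w\<bar> * norm (Q v) + l w * norm (Q (v - w))"
      using norm_triangle_ineq[of "(l v - l w) *\<^sub>R Q v" "l w *\<^sub>R Q (v - w)"] l(1)[of w] by simp
    also have "\<dots> \<le> norm (v - w) / (\<rho>' - \<rho>) * \<rho>' + 1 * norm (v - w)"
      using \<rho> l Qn that l_lip by (intro add_mono mult_mono order_trans[OF Qn]) auto
    also have "\<dots> = C * norm (v - w)" by (simp add: C_def algebra_simps)
    finally show ?thesis .
  qed
  have lip: "norm (l v *\<^sub>R Q v - l w *\<^sub>R Q w) \<le> C * norm (v - w)" for v w
  proof -
    consider "norm v \<le> \<rho>'" | "norm w \<le> \<rho>'" | "\<rho>' < norm v" "\<rho>' < norm w" by linarith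
    then show ?thesis
    proof cases
      case 2
      then show ?thesis using lip1[of w v] by (simp add: norm_minus_commute)
    next
      case 3
      then show ?thesis using l(4) C by simp
    qed (rule lip1)
  qed
  \<comment> \<open>Makes the perturbation of the identity Lipschitz with constant 1/2.\<close>
  define \<kappa> where "\<kappa> = 1 / (2 * C)"
  have \<kappa>: "0 < \<kappa>" "\<kappa> < 1" "\<kappa> * C = 1 / 2" using C by (simp_all add: \<kappa>_def field_simps)
  define s where "s v = v - \<kappa> *\<^sub>R (l v *\<^sub>R Q v)" for v
  have "\<exists>s'. homeomorphism UNIV UNIV s s'"
    unfolding s_def
  proof (rule homeomorphism_near_identity[of "1 / 2"])
    fix v w
    have "norm (\<kappa> *\<^sub>R l v *\<^sub>R Q v - \<kappa> *\<^sub>R l w *\<^sub>R Q w) = \<kappa> * norm (l v *\<^sub>R Q v - l w *\<^sub>R Q w)"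
      unfolding scaleR_diff_right[symmetric] using \<kappa>(1) by simp
    also have "\<dots> \<le> \<kappa> * (C * norm (v - w))" using \<kappa>(1) lip by (intro mult_left_mono) auto
    also have "\<dots> = 1 / 2 * norm (v - w)" using \<kappa>(3) by (simp flip: mult.assoc)
    finally show "norm (\<kappa> *\<^sub>R l v *\<^sub>R Q v - \<kappa> *\<^sub>R l w *\<^sub>R Q w) \<le> 1 / 2 * norm (v - w)" .
  qed auto
  then obtain s' where s': "homeomorphism UNIV UNIV s s'" by blast
  have s_b: "s v \<bullet> b = v \<bullet> b" for v by (simp add: s_def inner_diff_left Qb)
  have s_far: "s v = v" if "\<rho>' \<le> norm v" for v using l(4)[OF that] by (simp add: s_def)
  have s_near: "s v = v - \<kappa> *\<^sub>R Q v" if "norm v \<le> \<rho>" for v using l(3)[OF that] by (simp add: s_def)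
  have Qs: "Q (s v) = (1 - \<kappa>) *\<^sub>R Q v" if "norm v \<le> \<rho>" for v
    by (simp add: s_near[OF that] Q_diff Q_scale QQ algebra_simps)
  \<comment> \<open>\<open>s v\<close> is a convex combination of v and its projection to the
    b-axis, so the iterates stay where the cut-off is 1 and the contraction factors
    multiply.\<close>
  have ns: "norm (s v) \<le> \<rho>" if "norm v \<le> \<rho>" for v
  proof -
    have "s v = (1 - \<kappa>) *\<^sub>R v + \<kappa> *\<^sub>R (v - Q v)" by (simp add: s_near[OF that] algebra_simps)
    moreover have "norm (v - Q v) \<le> norm v"
      using Cauchy_Schwarz_ineq2[of v b] by (simp add: Q_def bb)
    ultimately have "norm (s v) \<le> (1 - \<kappa>) * norm v + \<kappa> * norm v"
      using norm_triangle_ineq[of "(1 - \<kappa>) *\<^sub>R v" "\<kappa> *\<^sub>R (v - Q v)"] \<kappa>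
      by (smt (verit) mult_left_mono norm_scaleR abs_of_pos)
    then show ?thesis using that by (simp add: algebra_simps)
  qed
  have hom: "\<exists>S'. homeomorphism UNIV UNIV (s ^^ n) S'" for n
  proof (induction n)
    case 0
    show ?case using homeomorphism_ident[of UNIV] by (auto simp: id_def)
  next
    case (Suc n)
    then obtain S' where "homeomorphism UNIV UNIV (s ^^ n) S'" by blast
    from homeomorphism_compose[OF this s'] show ?case unfolding funpow.simps(2) by (rule exI[of _ "S' \<circ> s'"])
  qed
  have S_b: "(s ^^ n) v \<bullet> b = v \<bullet> b" for n v by (induction n) (simp_all add: s_b)
  have S_far: "(s ^^ n) v = v" if "\<rho>' \<le> norm v" for n v by (induction n) (simp_all add: s_far that)
  have S_near: "norm ((s ^^ n) v) \<le> \<rho> \<and> Q ((s ^^ n) v) = (1 - \<kappa>) ^ n *\<^sub>R Q v" if "norm v \<le> \<rho>" for n v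
    by (induction n) (auto simp: that ns Qs)
  obtain n where n: "(1 - \<kappa>) ^ n < \<delta> / \<rho>"
    using real_arch_pow_inv[of "\<delta> / \<rho>" "1 - \<kappa>"] \<delta> \<rho> \<kappa> by auto
  have "norm (Q ((s ^^ n) v)) < \<delta>" if "norm v \<le> \<rho>" for v
  proof -
    have "norm (Q ((s ^^ n) v)) = (1 - \<kappa>) ^ n * norm (Q v)" using S_near[OF that, of n] \<kappa> by simp
    also have "\<dots> \<le> (1 - \<kappa>) ^ n * \<rho>" using \<kappa> Qn[of v] that by (intro mult_left_mono) auto
    also have "\<dots> < \<delta>" using n \<rho> by (simp add: field_simps)
    finally show ?thesis .
  qed
  then show ?thesis using hom[of n] S_b S_far unfolding Q_def by blast
qed

section \<open>Density of rich maps among homeomorphisms\<close>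

lemma obtain_symbol_number:
  assumes "0 < p"
  shows "\<exists>Q>0. real k \<le> ln (real Q) / real p"
proof -
  obtain Q :: nat where Q: "exp (real k * real p) \<le> real Q" using real_arch_simple by blast
  have "0 < exp (real k * real p)" by simp
  then have "0 < real Q" using Q by linarith
  moreover have "real k * real p \<le> ln (real Q)" using Q calculation by (simp add: ln_ge_iff)
  ultimately show ?thesis using assms by (intro exI[of _ Q]) (simp add: field_simps)
qed

lemma homeo_dense_rich:
  fixes A :: "('m::metric_space, 'e::euclidean_space) chart set" and f :: "'m \<Rightarrow> 'm"
  assumes M: "compact (UNIV :: 'm set)" and A: "smooth_atlas A" and dim: "2 \<le> DIM('e)"
    and f: "f \<in> homeos" and e: "0 < e"
  shows "\<exists>g\<in>homeos. dist_homeo f g < e \<and> rich g k"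
proof -
  have cf: "continuous_on UNIV f" "continuous_on UNIV (inv f)" using homeosD[OF f] by auto
  \<comment> \<open>Since \<open>inv g = inv f \<circ> inv \<eta>\<close>, the ball W must also be
    small relative to the modulus of continuity of \<open>inv f\<close>.\<close>
  have "uniformly_continuous_on UNIV (inv f)" by (rule compact_uniformly_continuous[OF cf(2) M])
  then obtain e1 where e1: "0 < e1" "\<And>x y. dist x y < e1 \<Longrightarrow> dist (inv f x) (inv f y) < e / 2"
    unfolding uniformly_continuous_on_def using half_gt_zero[OF e] by (metis UNIV_I dist_commute)
  have e2: "0 < min e1 (e / 2)" using e e1(1) by simp
  obtain W and c :: "'m \<Rightarrow> 'e" and d x p where W: "open W" and hom: "homeomorphism W (ball 0 1) c d"
    and x: "x \<in> W" "c x = 0" and p: "0 < p" and ret: "(f ^^ p) x \<in> W"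
    and first: "\<forall>l. 0 < l \<longrightarrow> l < p \<longrightarrow> (f ^^ l) x \<notin> W"
    and diam: "\<forall>z\<in>W. \<forall>w\<in>W. dist z w < min e1 (e / 2)"
    using first_return_chart[OF M A e2, of f] by blast
  have dcont: "continuous_on (ball 0 1) d" and ccont: "continuous_on W c" using hom by (simp_all add: homeomorphism_def)
  have cW: "c z \<in> ball 0 1" if "z \<in> W" for z using homeomorphism_image1[OF hom] that by blast
  have dW: "d v \<in> W" if "v \<in> ball 0 1" for v using homeomorphism_image2[OF hom] that by blast
  have cd: "c (d v) = v" if "v \<in> ball 0 1" for v using homeomorphism_apply2[OF hom that] .
  have dc: "d (c z) = z" if "z \<in> W" for z using homeomorphism_apply1[OF hom that] .
  obtain b :: 'e where b: "b \<in> Basis" using nonempty_Basis by blast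
  have bb: "b \<bullet> b = 1" "norm b = 1" using b by simp_all
  define F where "F = f ^^ p"
  have cF: "continuous_on UNIV F" unfolding F_def by (rule continuous_on_funpow[OF cf(1)])
  have "norm (c (F x)) < 1" using cW[OF ret] by (simp add: F_def)
  then obtain \<rho> where \<rho>: "norm (c (F x)) < \<rho>" "\<rho> < 1" using dense by blast
  have \<rho>0: "0 < \<rho>" using \<rho>(1) norm_ge_zero by (rule le_less_trans[rotated])
  obtain \<rho>' where \<rho>': "\<rho> < \<rho>'" "\<rho>' < 1" using dense \<rho>(2) by blast
  \<comment> \<open>The modification \<eta> will be the identity off this core. Avoiding the closed
    set C is an open condition, unlike avoiding W, so it persists from x to a neighbourhood.\<close>
  define C where "C = d ` cball 0 \<rho>'"
  have "compact C" unfolding C_def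
    by (intro compact_continuous_image continuous_on_subset[OF dcont]) (use \<rho>'(2) in auto)
  then have oC: "open (- C)" by (simp add: compact_imp_closed open_Compl)
  have CW: "C \<subseteq> W" using dW \<rho>'(2) by (auto simp: C_def)
  define H where "H = F -` (W \<inter> c -` ball 0 \<rho>) \<inter> (\<Inter>l\<in>{0<..<p}. (f ^^ l) -` (- C))"
  have "open H" unfolding H_def
  proof (intro open_Int open_INT ballI finite_greaterThanLessThan)
    show "open (F -` (W \<inter> c -` ball 0 \<rho>))"
      by (intro open_vimage[OF _ cF] continuous_open_preimage[OF ccont W] open_ball)
    show "open ((f ^^ l) -` (- C))" for l by (intro open_vimage[OF oC] continuous_on_funpow cf)
  qed
  moreover have "x \<in> H" unfolding H_def using ret \<rho>(1) first CW by (auto simp: F_def)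
  ultimately have "open (ball 0 1 \<inter> d -` H)" "0 \<in> ball 0 1 \<inter> d -` H"
    using continuous_open_preimage[OF dcont open_ball, of H] dc[OF x(1)] x(2) by auto
  then obtain r0 where r0: "0 < r0" "cball 0 r0 \<subseteq> ball 0 1 \<inter> d -` H"
    using open_contains_cball by blast
  have good: "v \<in> ball 0 1" "F (d v) \<in> W" "norm (c (F (d v))) < \<rho>"
    "\<And>l. 0 < l \<Longrightarrow> l < p \<Longrightarrow> (f ^^ l) (d v) \<notin> C" if "norm v \<le> r0" for v
    using subsetD[OF r0(2), of v] that by (auto simp: H_def)
  define r where "r = min r0 \<rho> / 4"
  have r: "0 < r" "2 * r < r0" "2 * r < \<rho>" using r0(1) \<rho>0 by (simp_all add: r_def)
  obtain Q where Q: "0 < Q" "real k \<le> ln (real Q) / real p" using obtain_symbol_number[OF p] by blast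
  define N where "N = 2 * Q"
  have N: "0 < N" using Q(1) by (simp add: N_def)
  define q where "q j = ((real j - N) * (r / N)) *\<^sub>R b" for j :: nat
  have q: "norm (q j) \<le> r" if "j < 2 * N" for j
  proof -
    have "\<bar>real j - N\<bar> \<le> N" using that by linarith
    then have "\<bar>real j - N\<bar> * (r / N) \<le> N * (r / N)" using r(1) by (intro mult_right_mono) auto
    then show ?thesis using r(1) N by (simp add: q_def bb abs_mult)
  qed
  have q_inj: "q i \<noteq> q j" if "i \<noteq> j" for i j
    using that r(1) N b by (auto simp: q_def nonzero_Basis)
  define w where "w j = c (F (d (q j)))" for j
  \<comment> \<open>The sign sends even faces beyond the left end and odd faces beyond the right
    end. The factor lies in (1, 2] and differs for each j, because a homeomorphism needs distinct
    targets.\<close>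
  define \<tau> where "\<tau> j = (if even j then - 1 else 1) * (1 + 1 / (real j + 1))" for j :: nat
  have \<tau>_abs: "\<bar>\<tau> j\<bar> = 1 + 1 / (real j + 1)" for j
    unfolding \<tau>_def abs_mult by simp
  define t where "t j = (\<tau> j * r) *\<^sub>R b" for j
  have "inj f" by (rule inj_on_inverseI[of _ "inv f"]) (rule homeosD(4)[OF f])
  then have F_inj: "inj F" unfolding F_def by (rule inj_fn)
  have w_inj: "w i \<noteq> w j" if "i \<noteq> j" "i < 2 * N" "j < 2 * N" for i j
  proof
    assume "w i = w j"
    have qr: "norm (q i) \<le> r0" "norm (q j) \<le> r0" using q[of i] q[of j] that r by auto
    then have "F (d (q i)) = F (d (q j))"
      using \<open>w i = w j\<close> dc[OF good(2)] unfolding w_def by metis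
    then have "d (q i) = d (q j)" using F_inj by (simp add: inj_eq)
    then have "q i = q j" using cd[OF good(1)] qr by metis
    then show False using q_inj that(1) by blast
  qed
  have t_inj: "t i \<noteq> t j" if "i \<noteq> j" for i j
  proof
    assume "t i = t j"
    then have "t i \<bullet> b = t j \<bullet> b" by simp
    then have "\<tau> i = \<tau> j" using r(1) by (simp add: t_def bb)
    then have "1 + 1 / (real i + 1) = 1 + 1 / (real j + 1)" unfolding \<tau>_abs[symmetric] by simp
    then show False using that by simp
  qed
  have t_norm: "norm (t j) < \<rho>" for j
  proof -
    have "norm (t j) = (1 + 1 / (real j + 1)) * r" using r(1) by (simp add: t_def bb abs_mult \<tau>_abs)
    also have "\<dots> \<le> 2 * r" using r(1) by (intro mult_right_mono) (auto simp: divide_le_eq)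
    finally show ?thesis using r(3) by simp
  qed
  have w_norm: "norm (w j) < \<rho>" if "j < 2 * N" for j
    unfolding w_def using q[OF that] r by (intro good(3)) auto
  have aff: "affine hull (ball (0::'e) \<rho>) = UNIV" by (rule affine_hull_open) (use \<rho>0 in auto)
  have pw: "pairwise (\<lambda>i j. (w i \<noteq> w j) \<and> (t i \<noteq> t j)) {..<2 * N}"
    using w_inj t_inj by (auto simp: pairwise_def)
  have mem: "w i \<in> ball 0 \<rho> \<and> t i \<in> ball 0 \<rho>" if "i \<in> {..<2 * N}" for i
    using w_norm[of i] t_norm[of i] that by simp
  have hull: "UNIV \<subseteq> affine hull (ball (0::'e) \<rho>)" by (simp add: aff)
  have "\<exists>P P'. homeomorphism (UNIV :: 'e set) (UNIV :: 'e set) P P' \<and> (\<forall>j\<in>{..<2 * N}. P (w j) = t j) \<and>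
      {v. \<not> (P v = v \<and> P' v = v)} \<subseteq> ball 0 \<rho>"
  proof (rule homeomorphism_moving_points_exists[OF dim open_ball connected_ball subset_UNIV finite_lessThan
        mem pw subset_UNIV hull connected_ball])
    fix P P' :: "'e \<Rightarrow> 'e"
    assume "homeomorphism UNIV UNIV P P'" "\<And>j. j \<in> {..<2 * N} \<Longrightarrow> P (w j) = t j"
      "{v. \<not> (P v = v \<and> P' v = v)} \<subseteq> ball 0 \<rho>"
    then show ?thesis by (intro exI[of _ P] exI[of _ P']) simp
  qed
  then obtain P P' where P: "homeomorphism (UNIV :: 'e set) (UNIV :: 'e set) P P'"
    and Pw: "\<forall>j\<in>{..<2 * N}. P (w j) = t j"
    and supp: "{v. \<not> (P v = v \<and> P' v = v)} \<subseteq> ball 0 \<rho>"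
    by blast
  have P_far: "P v = v" "P' v = v" if "\<rho> \<le> norm v" for v
  proof -
    have "v \<notin> ball 0 \<rho>" using that by simp
    then show "P v = v" "P' v = v" using supp by blast+
  qed
  have P_ball: "norm (P v) < \<rho>" if "norm v < \<rho>" for v
  proof (rule ccontr)
    assume *: "\<not> norm (P v) < \<rho>"
    then have "P' (P v) = P v" by (intro P_far) simp
    then show False using that * homeomorphism_apply1[OF P, of v] by simp
  qed
  have cP: "continuous_on UNIV P" using P by (simp add: homeomorphism_def)
  define \<phi> where "\<phi> v = P (c (F (d v))) \<bullet> b" for v
  have "continuous_on (ball 0 r0) (\<lambda>v. F (d v))"
    by (rule continuous_on_compose2[OF cF continuous_on_subset[OF dcont]]) (use good(1) in auto)
  then have "continuous_on (ball 0 r0) (\<lambda>v. c (F (d v)))"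
    by (rule continuous_on_compose2[OF ccont]) (use good(2) in auto)
  then have c\<phi>: "continuous_on (ball 0 r0) \<phi>"
    unfolding \<phi>_def by (intro continuous_intros continuous_on_compose2[OF cP]) auto
  \<comment> \<open>P prescribes only the images of the face centres; continuity extends the
    inequality to a neighbourhood, and \<delta> is then chosen so that each whole face fits into
    it.\<close>
  have "\<exists>\<epsilon>>0. \<forall>v. dist v (q j) < \<epsilon> \<longrightarrow> (if even j then \<phi> v < - r else r < \<phi> v)"
    if j: "j \<in> {..<2 * N}" for j
  proof -
    have "norm (q j) < r0" using q[of j] j r by simp
    then have qin: "q j \<in> ball 0 r0" by simp
    have "\<phi> (q j) = \<tau> j * r"
      using bspec[OF Pw j] by (simp add: \<phi>_def w_def[symmetric] t_def bb)
    moreover have "0 < r / (real j + 1)" using r(1) by simp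
    ultimately have val: "if even j then \<phi> (q j) < - r else r < \<phi> (q j)"
      by (cases "even j") (simp_all add: \<tau>_def algebra_simps)
    define O' where "O' = (if even j then {..< - r} else {r<..})"
    have "open O'" by (simp add: O'_def)
    then have "open (ball 0 r0 \<inter> \<phi> -` O')" by (intro continuous_open_preimage[OF c\<phi>]) auto
    moreover have "q j \<in> ball 0 r0 \<inter> \<phi> -` O'" using qin val by (simp add: O'_def)
    ultimately obtain \<epsilon> where "0 < \<epsilon>" "ball (q j) \<epsilon> \<subseteq> ball 0 r0 \<inter> \<phi> -` O'"
      by (meson open_contains_ball)
    then show ?thesis
      by (intro exI[of _ \<epsilon>]) (auto simp: O'_def subset_iff dist_commute split: if_splits)
  qed
  then have "\<exists>\<epsilon>. \<forall>j\<in>{..<2 * N}. 0 < \<epsilon> j \<and> (\<forall>v. dist v (q j) < \<epsilon> j \<longrightarrow> (if even j then \<phi> v < - r else r < \<phi> v))"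
    by (intro bchoice) blast
  then obtain \<epsilon> where \<epsilon>: "\<And>j. j < 2 * N \<Longrightarrow> 0 < \<epsilon> j"
    "\<And>j v. j < 2 * N \<Longrightarrow> dist v (q j) < \<epsilon> j \<Longrightarrow> (if even j then \<phi> v < - r else r < \<phi> v)"
    by blast
  define \<delta> where "\<delta> = Min (insert r (\<epsilon> ` {..<2 * N})) / 2"
  have \<delta>: "0 < \<delta>" using \<epsilon>(1) r(1) by (simp add: \<delta>_def)
  have "2 * \<delta> \<le> r" by (simp add: \<delta>_def)
  then have \<delta>r: "\<delta> < r" using \<delta> by linarith
  have \<delta>\<epsilon>: "\<delta> < \<epsilon> j" if "j < 2 * N" for j
  proof -
    have "2 * \<delta> \<le> \<epsilon> j" using that by (simp add: \<delta>_def)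
    then show ?thesis using \<delta> by linarith
  qed
  \<comment> \<open>The image must be thinner than a box whose thinness already depends on P. There
    is no circularity: S is built after \<delta> and preserves b-coordinates, so the faces keep
    their positions.\<close>
  obtain S S' where S: "homeomorphism (UNIV :: 'e set) UNIV S S'" and Sb: "\<forall>v. S v \<bullet> b = v \<bullet> b"
    and S_far: "\<forall>v. \<rho>' \<le> norm v \<longrightarrow> S v = v"
    and S_thin: "\<forall>v. norm v \<le> \<rho> \<longrightarrow> norm (S v - (S v \<bullet> b) *\<^sub>R b) < \<delta>"
    using squeeze_homeomorphism[OF b \<rho>0 \<rho>'(1) \<delta>] by blast
  have T: "homeomorphism UNIV UNIV (S \<circ> P) (P' \<circ> S')" by (rule homeomorphism_compose[OF P S])
  have T_far: "(S \<circ> P) v = v" if "\<rho>' \<le> norm v" for v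
    using P_far(1)[of v] S_far that \<rho>'(1) by simp
  obtain \<eta> where \<eta>: "\<eta> \<in> homeos"
    and \<eta>W: "\<forall>z\<in>W. \<eta> z = d ((S \<circ> P) (c z)) \<and> \<eta> z \<in> W \<and> c (\<eta> z) = (S \<circ> P) (c z)"
    and \<eta>_out: "\<forall>z. z \<notin> W \<longrightarrow> \<eta> z = z" and \<eta>_inv: "\<forall>z\<in>W. inv \<eta> z \<in> W" "\<forall>z. z \<notin> W \<longrightarrow> inv \<eta> z = z"
    using extend_homeo[OF hom W T \<rho>'(2) T_far] by blast
  have \<eta>_C: "\<eta> z = z" if "z \<notin> C" for z
  proof (cases "z \<in> W")
    case True
    have "\<not> norm (c z) \<le> \<rho>'"
    proof
      assume "norm (c z) \<le> \<rho>'"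
      then have "d (c z) \<in> C" by (simp add: C_def)
      then show False using dc[OF True] that by simp
    qed
    then have "(S \<circ> P) (c z) = c z" by (intro T_far) simp
    then show ?thesis using \<eta>W True dc[OF True] by simp
  qed (use \<eta>_out in blast)
  define g where "g = \<eta> \<circ> f"
  have g_cont: "continuous_on UNIV g" "continuous_on UNIV (inv f \<circ> inv \<eta>)"
    unfolding g_def
    by (intro continuous_on_compose continuous_on_subset[OF homeosD(1)[OF \<eta>]]
        continuous_on_subset[OF cf(2)] homeosD(2)[OF \<eta>] cf(1) subset_UNIV)+
  have g: "g \<in> homeos" "inv g = inv f \<circ> inv \<eta>"
    by (rule homeosI[OF g_cont]; simp add: g_def homeosD[OF f] homeosD[OF \<eta>])+
  have "dist_homeo f g \<le> e / 2"
  proof (rule dist_homeo_le)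
    fix z
    show "dist (f z) (g z) \<le> e / 2"
    proof (cases "f z \<in> W")
      case True
      then have "dist (f z) (\<eta> (f z)) < min e1 (e / 2)" using diam \<eta>W by blast
      then show ?thesis by (simp add: g_def)
    qed (use \<eta>_out e in \<open>simp add: g_def\<close>)
    show "dist (inv f z) (inv g z) \<le> e / 2"
    proof (cases "z \<in> W")
      case True
      then have "dist z (inv \<eta> z) < min e1 (e / 2)" using diam \<eta>_inv(1) by blast
      then have "dist (inv f z) (inv f (inv \<eta> z)) < e / 2" by (intro e1(2)) simp
      then show ?thesis by (simp add: g(2))
    qed (use \<eta>_inv(2) e in \<open>simp add: g(2)\<close>)
  qed
  then have close: "dist_homeo f g < e" using e by linarith
  \<comment> \<open>Before time p the orbit avoids C, where alone \<eta> can move points; \<eta>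
    acts only at the return.\<close>
  have step: "(g ^^ l) (d v) = (f ^^ l) (d v)" if "norm v \<le> r0" "l < p" for v l
    using that(2)
  proof (induction l)
    case (Suc l)
    then show ?case using good(4)[OF that(1), of "Suc l"] \<eta>_C by (simp add: g_def)
  qed simp
  have last: "(g ^^ p) (d v) = \<eta> (F (d v))" if "norm v \<le> r0" for v
  proof -
    obtain l where l: "p = Suc l" using p gr0_implies_Suc by blast
    show ?thesis using step[OF that, of l] by (simp add: l F_def g_def)
  qed
  have c_last: "c ((g ^^ p) (d v)) = S (P (c (F (d v))))" "(g ^^ p) (d v) \<in> W" if "norm v \<le> r0" for v
    unfolding last[OF that] using bspec[OF \<eta>W good(2)[OF that], unfolded comp_apply] by blast+
  define Box where "Box = {v :: 'e. \<bar>v \<bullet> b\<bar> \<le> r \<and> norm (v - (v \<bullet> b) *\<^sub>R b) \<le> \<delta>}"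
  have Box: "norm v \<le> 2 * r" if "v \<in> Box" for v
  proof -
    have "norm v \<le> norm ((v \<bullet> b) *\<^sub>R b) + norm (v - (v \<bullet> b) *\<^sub>R b)"
      using norm_triangle_ineq[of "(v \<bullet> b) *\<^sub>R b" "v - (v \<bullet> b) *\<^sub>R b"] by simp
    moreover have "norm ((v \<bullet> b) *\<^sub>R b) \<le> r" using that by (simp add: Box_def bb)
    ultimately show ?thesis using that \<delta>r by (simp add: Box_def)
  qed
  have Box_r0: "norm v \<le> r0" if "v \<in> Box" for v using Box[OF that] r(2) by simp
  have face: "if even j then \<phi> v < - r else r < \<phi> v"
    if "j < 2 * N" "v \<in> Box" "v \<bullet> b = (real j - N) * (r / N)" for j v
  proof (rule \<epsilon>(2)[OF that(1)])
    have "q j = (v \<bullet> b) *\<^sub>R b" by (simp add: q_def that(3))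
    then have "dist v (q j) \<le> \<delta>" using that(2) by (simp add: dist_norm Box_def)
    then show "dist v (q j) < \<epsilon> j" using \<delta>\<epsilon>[OF that(1)] by simp
  qed
  have "\<exists>V W' u \<gamma>. horseshoe g p N V W' u \<gamma>"
  proof (rule chart_horseshoe[OF hom W b r(1) \<delta> _ p N], unfold Box_def[symmetric])
    show "r + \<delta> < 1" using \<delta>r r(3) \<rho>(2) by linarith
    fix v assume v: "v \<in> Box"
    show "(g ^^ p) (d v) \<in> W" using c_last(2) Box_r0[OF v] by blast
    have "norm (P (c (F (d v)))) \<le> \<rho>" using P_ball good(3)[OF Box_r0[OF v]] by (simp add: less_imp_le)
    then show "norm (c ((g ^^ p) (d v)) - (c ((g ^^ p) (d v)) \<bullet> b) *\<^sub>R b) < \<delta>"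
      using S_thin unfolding c_last(1)[OF Box_r0[OF v]] by blast
    have c_b: "c ((g ^^ p) (d v)) \<bullet> b = \<phi> v"
      unfolding c_last(1)[OF Box_r0[OF v]] \<phi>_def using Sb by simp
    show "(g ^^ l) (d v) \<notin> d ` Box" if "0 < l" "l < p" for l
    proof -
      have "d ` Box \<subseteq> C" using Box r(3) \<rho>'(1) by (force simp: C_def)
      then show ?thesis using good(4)[OF Box_r0[OF v] that] step[OF Box_r0[OF v] that(2)] by auto
    qed
    show "c ((g ^^ p) (d v)) \<bullet> b < - r" if "i < N" "v \<bullet> b = (2 * real i - N) * (r / N)" for i
      using face[of "2 * i" v] that v unfolding c_b by simp
    show "r < c ((g ^^ p) (d v)) \<bullet> b" if "i < N" "v \<bullet> b = (2 * real i + 1 - N) * (r / N)" for i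
      using face[of "2 * i + 1" v] that v unfolding c_b by (simp add: add_ac)
  qed
  then have "rich g k" unfolding rich_def using Q N_def by blast
  with g(1) close show ?thesis by blast
qed

section \<open>Density of rich maps among continuous maps\<close>

lemma continuous_onI_local:
  fixes g :: "'a::metric_space \<Rightarrow> 'b::metric_space"
  assumes "\<And>z. \<exists>U. open U \<and> z \<in> U \<and> continuous_on U g"
  shows "continuous_on UNIV g"
  unfolding continuous_on_eq_continuous_at[OF open_UNIV]
proof
  fix z
  obtain U where "open U" "z \<in> U" "continuous_on U g" using assms by blast
  then show "isCont g z" by (simp add: continuous_on_eq_continuous_at)
qed

text \<open>The filter form lets finitely many smallness conditions be met by one radius.\<close>

lemma eventually_small_chart_ball:
  fixes c :: "'m::metric_space \<Rightarrow> 'e::euclidean_space"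
  assumes hom: "homeomorphism W (ball 0 1) c d" and "open H" "d 0 \<in> H"
  shows "\<forall>\<^sub>F \<rho> in at_right 0. d ` ball 0 \<rho> \<subseteq> H"
proof -
  have "continuous_on (ball 0 1) d" using hom by (simp add: homeomorphism_def)
  then have "open (ball 0 1 \<inter> d -` H)" using \<open>open H\<close> by (intro continuous_open_preimage) auto
  moreover have "0 \<in> ball 0 1 \<inter> d -` H" using assms(3) by simp
  ultimately obtain R where R: "0 < R" "ball 0 R \<subseteq> ball 0 1 \<inter> d -` H" by (meson open_contains_ball)
  have "d ` ball 0 \<rho> \<subseteq> H" if "\<rho> < R" for \<rho>
  proof -
    have "ball 0 \<rho> \<subseteq> ball (0::'e) R" using that by auto
    then show ?thesis using R(2) by blast
  qed
  then show ?thesis using R(1) by (auto simp: eventually_at_right_field)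
qed

text \<open>
  Near each point \<open>f\<^sup>l x\<close> of an almost closed orbit the map is replaced, in charts, by one that keeps
  only the coordinate along \<open>b\<close>; the last of these maps folds that coordinate by a cosine.
\<close>

lemma C0_dense_rich:
  fixes A :: "('m::metric_space, 'e::euclidean_space) chart set" and f :: "'m \<Rightarrow> 'm"
  assumes M: "compact (UNIV :: 'm set)" and A: "smooth_atlas A"
    and f: "continuous_on UNIV f" and e: "0 < e"
  shows "\<exists>g. continuous_on UNIV g \<and> dist_C0 f g < e \<and> rich g k"
proof -
  obtain W0 and c0 :: "'m \<Rightarrow> 'e" and d0 x p where W0: "open W0" "homeomorphism W0 (ball 0 1) c0 d0"
    "x \<in> W0" "c0 x = 0" and p: "0 < p" and ret: "(f ^^ p) x \<in> W0"
    and first: "\<forall>l. 0 < l \<longrightarrow> l < p \<longrightarrow> (f ^^ l) x \<notin> W0"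
    and diam0: "\<forall>z\<in>W0. \<forall>w\<in>W0. dist z w < e / 2"
    using first_return_chart[OF M A half_gt_zero[OF e], of f] by blast
  define y where "y l = (f ^^ l) x" for l
  have "\<exists>W c d. open W \<and> y l \<in> W \<and> homeomorphism W (ball (0::'e) 1) c d \<and> c (y l) = 0 \<and>
      (\<forall>z\<in>W. \<forall>w\<in>W. dist z w < e / 2) \<and> (l = 0 \<longrightarrow> W = W0)" for l
  proof (cases "l = 0")
    case True
    then show ?thesis using W0 diam0
      by (intro exI[of _ W0] exI[of _ c0] exI[of _ d0]) (simp add: y_def)
  next
    case False
    have "0 < e / 4" using e by simp
    then obtain W c d where W: "open W" "y l \<in> W" "homeomorphism W (ball (0::'e) 1) c d" "c (y l) = 0"
      "\<forall>z\<in>W. dist (y l) z < e / 4"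
      using chart_ball[OF A, of "e / 4" "y l"] by blast
    have "dist z w < e / 2" if "z \<in> W" "w \<in> W" for z w
      using bspec[OF W(5) that(1)] bspec[OF W(5) that(2)] dist_triangle3[of z w "y l"] by linarith
    with W False show ?thesis by (intro exI[of _ W] exI[of _ c] exI[of _ d]) simp
  qed
  then have "\<forall>l. \<exists>W c d. open W \<and> y l \<in> W \<and> homeomorphism W (ball (0::'e) 1) c d \<and> c (y l) = 0 \<and>
      (\<forall>z\<in>W. \<forall>w\<in>W. dist z w < e / 2) \<and> (l = 0 \<longrightarrow> W = W0)" by blast
  then obtain W and c :: "nat \<Rightarrow> 'm \<Rightarrow> 'e" and d where charts:
    "\<forall>l. open (W l) \<and> y l \<in> W l \<and> homeomorphism (W l) (ball (0::'e) 1) (c l) (d l) \<and> c l (y l) = 0 \<and>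
      (\<forall>z\<in>W l. \<forall>w\<in>W l. dist z w < e / 2) \<and> (l = 0 \<longrightarrow> W l = W0)"
    unfolding choice_iff by blast
  have W: "open (W l)" "y l \<in> W l" and hom: "homeomorphism (W l) (ball (0::'e) 1) (c l) (d l)"
    and cy: "c l (y l) = 0" and diam: "\<And>z w. z \<in> W l \<Longrightarrow> w \<in> W l \<Longrightarrow> dist z w < e / 2" for l
    using charts by blast+
  have W_0: "W 0 = W0" using charts by blast
  have dcont: "continuous_on (ball 0 1) (d l)" and ccont: "continuous_on (W l) (c l)" for l
    using hom[of l] by (simp_all add: homeomorphism_def)
  have cW: "c l z \<in> ball 0 1" if "z \<in> W l" for l z using homeomorphism_image1[OF hom] that by blast
  have dW: "d l v \<in> W l" if "v \<in> ball 0 1" for l v using homeomorphism_image2[OF hom] that by blast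
  have cd: "c l (d l v) = v" if "v \<in> ball 0 1" for l v using homeomorphism_apply2[OF hom that] .
  have dc: "d l (c l z) = z" if "z \<in> W l" for l z using homeomorphism_apply1[OF hom that] .
  have d0: "d l 0 = y l" for l using dc[OF W(2), of l] cy[of l] by simp
  obtain b :: 'e where b: "b \<in> Basis" using nonempty_Basis by blast
  have bb: "b \<bullet> b = 1" "norm b = 1" using b by simp_all
  \<comment> \<open>The last chart is followed by chart 0, although the return point
    \<open>f (y (p - 1))\<close> only lies in \<open>W 0\<close> and need not equal
    \<open>y 0\<close>.\<close>
  define nx where "nx l = (if Suc l < p then Suc l else 0)" for l
  have fy: "f (y l) \<in> W (nx l)" if "l < p" for l
  proof (cases "Suc l < p")
    case True
    then show ?thesis using W(2)[of "Suc l"] by (simp add: nx_def y_def)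
  next
    case False
    then have "p = Suc l" using that by simp
    then show ?thesis using ret False by (simp add: nx_def y_def W_0)
  qed
  \<comment> \<open>A coincidence would make the orbit reach the return point already at time
    \<open>p - l' + l\<close>, which is less than p.\<close>
  have y_inj: "y l \<noteq> y l'" if "l < l'" "l' < p" for l l'
  proof
    assume "y l = y l'"
    then have "(f ^^ (p - l')) (y l) = (f ^^ (p - l')) (y l')" by simp
    then have "(f ^^ (p - l' + l)) x = (f ^^ (p - l' + l')) x" by (simp add: y_def funpow_add)
    then have mem: "(f ^^ (p - l' + l)) x \<in> W0" using ret that by simp
    have "0 < p - l' + l" "p - l' + l < p" using that by auto
    then have "(f ^^ (p - l' + l)) x \<notin> W0" by (rule first[rule_format])
    with mem show False by contradiction
  qed
  have ev_f: "\<forall>\<^sub>F \<rho> in at_right 0. d l ` ball 0 \<rho> \<subseteq> f -` W (nx l)" if "l < p" for l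
    using fy[OF that] W(1) by (intro eventually_small_chart_ball[OF hom] open_vimage f) (simp_all add: d0)
  have ev_disj: "\<forall>\<^sub>F \<rho> in at_right 0. d l ` ball 0 \<rho> \<inter> d l' ` ball 0 \<rho> = {}" if l: "l < l'" "l' < p" for l l'
  proof -
    obtain G G' where G: "open G" "open G'" "y l \<in> G" "y l' \<in> G'" "G \<inter> G' = {}"
      using hausdorff[OF y_inj[OF l]] by blast
    have "\<forall>\<^sub>F \<rho> in at_right 0. d l ` ball 0 \<rho> \<subseteq> G" "\<forall>\<^sub>F \<rho> in at_right 0. d l' ` ball 0 \<rho> \<subseteq> G'"
      using G by (intro eventually_small_chart_ball[OF hom]; simp add: d0)+
    then show ?thesis by eventually_elim (use G(5) in blast)
  qed
  have ev1: "\<forall>\<^sub>F \<rho> in at_right 0. \<forall>l\<in>{..<p}. d l ` ball 0 \<rho> \<subseteq> f -` W (nx l)"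
    by (rule eventually_ball_finite) (use ev_f in auto)
  have ev2: "\<forall>\<^sub>F \<rho> in at_right 0. \<forall>l'\<in>{..<p}. \<forall>l\<in>{..<l'}. d l ` ball 0 \<rho> \<inter> d l' ` ball 0 \<rho> = {}"
    by (intro eventually_ball_finite ballI finite_lessThan) (use ev_disj in auto)
  have ev3: "\<forall>\<^sub>F \<rho> in at_right (0::real). 0 < \<rho> \<and> \<rho> < 1"
    by (auto simp: eventually_at_right_field intro: exI[of _ 1])
  obtain \<rho> :: real where \<rho>f: "\<forall>l\<in>{..<p}. d l ` ball 0 \<rho> \<subseteq> f -` W (nx l)"
    and \<rho>disj: "\<forall>l'\<in>{..<p}. \<forall>l\<in>{..<l'}. d l ` ball 0 \<rho> \<inter> d l' ` ball 0 \<rho> = {}" and \<rho>: "0 < \<rho>" "\<rho> < 1"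
    using eventually_happens[OF eventually_conj[OF ev1 eventually_conj[OF ev2 ev3]]] by auto
  define V where "V l = d l ` ball 0 \<rho>" for l
  have V_sub: "V l \<subseteq> W l" for l using dW \<rho>(2) by (auto simp: V_def)
  have Vc: "norm (c l z) < \<rho>" if "z \<in> V l" for l z using that cd \<rho>(2) by (auto simp: V_def)
  have V_open: "open (V l)" for l
  proof -
    have "openin (top_of_set (ball 0 1)) (ball (0::'e) \<rho>)" using \<rho>(2) by (intro open_subset) auto
    then have "openin (top_of_set (W l)) (V l)"
      unfolding V_def by (rule homeomorphism_imp_open_map[OF homeomorphism_symD[OF hom]])
    then show ?thesis using W(1) by (simp add: openin_open_eq)
  qed
  have V_f: "f z \<in> W (nx l)" if "l < p" "z \<in> V l" for l z using \<rho>f that by (auto simp: V_def)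
  have V_uniq: "l = l'" if "l < p" "l' < p" "z \<in> V l" "z \<in> V l'" for l l' z
  proof (rule ccontr)
    assume "l \<noteq> l'"
    then consider "l < l'" | "l' < l" by linarith
    then show False
    proof cases
      case 1
      then have "V l \<inter> V l' = {}" using \<rho>disj that(2) by (simp add: V_def)
      then show False using that by blast
    next
      case 2
      then have "V l' \<inter> V l = {}" using \<rho>disj that(1) by (simp add: V_def)
      then show False using that by blast
    qed
  qed
  define C where "C l = d l ` cball 0 (3 * \<rho> / 4)" for l
  have C_closed: "closed (C l)" for l unfolding C_def
    by (intro compact_imp_closed compact_continuous_image continuous_on_subset[OF dcont])
      (use \<rho> in auto)
  obtain Q where Q: "0 < Q" "real k \<le> ln (real Q) / real p" using obtain_symbol_number[OF p] by blast
  define N where "N = 2 * Q"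
  have N: "0 < N" using Q(1) by (simp add: N_def)
  define r where "r = \<rho> / 8"
  have r: "0 < r" using \<rho>(1) by (simp add: r_def)
  \<comment> \<open>At the j-th face, \<open>t = (j - N) * (r / N)\<close>, the argument of the
    cosine is \<open>pi * j\<close>; the values alternate between \<open>- 2 * r\<close> and
    \<open>2 * r\<close>, beyond both ends of the box.\<close>
  define \<psi> where "\<psi> t = - 2 * r * cos (pi * (t / (r / N) + N))" for t :: real
  have \<psi>_le: "\<bar>\<psi> t\<bar> \<le> 2 * r" for t
  proof -
    have "\<bar>\<psi> t\<bar> = 2 * r * \<bar>cos (pi * (t / (r / N) + N))\<bar>" using r by (simp add: \<psi>_def abs_mult)
    also have "\<dots> \<le> 2 * r * 1" using r by (intro mult_left_mono abs_cos_le_one) auto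
    finally show ?thesis by simp
  qed
  \<comment> \<open>Equal to 1 up to radius \<open>\<rho> / 2\<close>, which contains the box, and 0
    from \<open>3 * \<rho> / 4\<close> on, strictly inside \<open>V l\<close>, so that g glues
    continuously with f.\<close>
  define \<Lambda> where "\<Lambda> v = max 0 (min 1 (3 - 4 * norm v / \<rho>))" for v :: 'e
  have \<Lambda>: "0 \<le> \<Lambda> v" "\<Lambda> v \<le> 1" for v by (simp_all add: \<Lambda>_def)
  have \<Lambda>1: "\<Lambda> v = 1" if "norm v \<le> \<rho> / 2" for v
    using that \<rho>(1) by (simp add: \<Lambda>_def field_simps)
  have \<Lambda>0: "\<Lambda> v = 0" if "3 * \<rho> / 4 \<le> norm v" for v
    using that \<rho>(1) by (simp add: \<Lambda>_def field_simps)
  define h where "h l t = (if Suc l < p then t else \<psi> t)" for l t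
  have h_cont: "continuous_on UNIV (h l)" for l
    unfolding h_def \<psi>_def using r N by (cases "Suc l < p") (auto intro!: continuous_intros)
  have h_le: "\<bar>h l t\<bar> < 1" if "\<bar>t\<bar> < \<rho>" for l t
    using that \<psi>_le[of t] \<rho> by (simp add: h_def r_def)
  \<comment> \<open>Interpolation in the target chart between f and the model map. Convexity of the
    ball keeps the value in the chart, whose image W has diameter at most \<open>e / 2\<close>, so g
    stays close to f.\<close>
  define mix where "mix l z = (1 - \<Lambda> (c l z)) *\<^sub>R c (nx l) (f z) + \<Lambda> (c l z) *\<^sub>R (h l (c l z \<bullet> b) *\<^sub>R b)" for l z
  have mix_ball: "mix l z \<in> ball 0 1" if "l < p" "z \<in> V l" for l z
  proof -
    have "\<bar>c l z \<bullet> b\<bar> \<le> norm (c l z)" using Cauchy_Schwarz_ineq2[of "c l z" b] by (simp add: bb)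
    then have "\<bar>h l (c l z \<bullet> b)\<bar> < 1" using Vc[OF that(2)] by (intro h_le) simp
    then have "h l (c l z \<bullet> b) *\<^sub>R b \<in> ball 0 1" by (simp add: bb)
    moreover have "c (nx l) (f z) \<in> ball 0 1" by (rule cW) (rule V_f[OF that])
    ultimately show ?thesis unfolding mix_def using \<Lambda>
      by (intro convexD[OF convex_ball]) auto
  qed
  have mix_cont: "continuous_on (V l) (mix l)" if l: "l < p" for l
  proof -
    have 1: "continuous_on (V l) (c l)" by (rule continuous_on_subset[OF ccont V_sub])
    have 2: "continuous_on (V l) (\<lambda>z. c (nx l) (f z))"
      by (rule continuous_on_compose2[OF ccont continuous_on_subset[OF f]]) (use V_f[OF l] in auto)
    have 3: "continuous_on (V l) (\<lambda>z. \<Lambda> (c l z))"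
      unfolding \<Lambda>_def using \<rho>(1) by (intro continuous_intros 1) auto
    have 4: "continuous_on (V l) (\<lambda>z. h l (c l z \<bullet> b))"
      by (rule continuous_on_compose2[OF h_cont]) (auto intro!: continuous_intros 1)
    show ?thesis unfolding mix_def by (intro continuous_intros 2 3 4)
  qed
  define g where "g z = (if \<exists>l<p. z \<in> V l
      then d (nx (THE l. l < p \<and> z \<in> V l)) (mix (THE l. l < p \<and> z \<in> V l) z) else f z)" for z
  have g_V: "g z = d (nx l) (mix l z)" if "l < p" "z \<in> V l" for l z
  proof -
    have "(THE l. l < p \<and> z \<in> V l) = l" using that V_uniq by blast
    then show ?thesis using that by (auto simp: g_def)
  qed
  have g_out: "g z = f z" if "\<not> (\<exists>l<p. z \<in> V l)" for z
    unfolding g_def using that by (rule if_not_P)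
  have g_f: "g z = f z" if out: "\<forall>l<p. z \<notin> C l" for z
  proof (cases "\<exists>l<p. z \<in> V l")
    case True
    then obtain l where l: "l < p" "z \<in> V l" by blast
    have "z \<in> W l" using V_sub l(2) by blast
    have "\<not> norm (c l z) \<le> 3 * \<rho> / 4"
    proof
      assume "norm (c l z) \<le> 3 * \<rho> / 4"
      then have "d l (c l z) \<in> C l" by (simp add: C_def)
      then show False using out l(1) dc[OF \<open>z \<in> W l\<close>] by simp
    qed
    then have "mix l z = c (nx l) (f z)" by (simp add: mix_def \<Lambda>0)
    then show ?thesis using g_V[OF l] dc[OF V_f[OF l]] by simp
  qed (rule g_out)
  have g_cont: "continuous_on UNIV g"
  proof (rule continuous_onI_local)
    fix z
    show "\<exists>U. open U \<and> z \<in> U \<and> continuous_on U g"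
    proof (cases "\<exists>l<p. z \<in> V l")
      case True
      then obtain l where l: "l < p" "z \<in> V l" by blast
      have "continuous_on (V l) (\<lambda>z. d (nx l) (mix l z))"
        by (rule continuous_on_compose2[OF dcont mix_cont[OF l(1)]]) (use mix_ball[OF l(1)] in blast)
      then have "continuous_on (V l) g" by (rule continuous_on_eq) (simp add: g_V[OF l(1)])
      then show ?thesis using V_open l(2) by blast
    next
      case False
      define U where "U = (\<Inter>l\<in>{..<p}. - C l)"
      have "open U" unfolding U_def by (intro open_INT ballI open_Compl C_closed finite_lessThan)
      moreover have "C l \<subseteq> V l" for l using \<rho>(1) by (auto simp: C_def V_def)
      then have "z \<in> U" using False by (auto simp: U_def)
      moreover have "continuous_on U g"
        by (rule continuous_on_eq[OF continuous_on_subset[OF f subset_UNIV]]) (simp add: g_f U_def)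
      ultimately show ?thesis by blast
    qed
  qed
  have "dist_C0 f g \<le> e / 2"
  proof (rule dist_C0_le)
    fix z
    show "dist (f z) (g z) \<le> e / 2"
    proof (cases "\<exists>l<p. z \<in> V l")
      case True
      then obtain l where l: "l < p" "z \<in> V l" by blast
      have "dist (f z) (g z) < e / 2"
        unfolding g_V[OF l] by (intro diam[of _ "nx l"] V_f[OF l] dW mix_ball[OF l])
      then show ?thesis by simp
    next
      case False
      show ?thesis unfolding g_out[OF False] using e by simp
    qed
  qed
  then have close: "dist_C0 f g < e" using e by linarith
  have g_core: "g (d l v) = d (nx l) (h l (v \<bullet> b) *\<^sub>R b)" if "l < p" "norm v \<le> \<rho> / 2" for l v
  proof -
    have v: "v \<in> ball 0 1" and "d l v \<in> V l" using that(2) \<rho> by (auto simp: V_def)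
    then show ?thesis
      by (simp add: g_V[OF that(1) \<open>d l v \<in> V l\<close>] mix_def cd[OF v] \<Lambda>1[OF that(2)])
  qed
  have abs_b: "\<bar>v \<bullet> b\<bar> \<le> norm v" for v using Cauchy_Schwarz_ineq2[of v b] by (simp add: bb)
  \<comment> \<open>After one step the transverse coordinates are lost and the point lies on the
    axis of its chart; the b-coordinate survives until the final fold. Thinness is thus automatic,
    without a squeezing map.\<close>
  have orbit: "\<exists>v'. norm v' \<le> \<rho> / 2 \<and> v' \<bullet> b = v \<bullet> b \<and> (g ^^ l) (d 0 v) = d l v'"
    if "norm v \<le> \<rho> / 2" "l < p" for v l
    using that(2)
  proof (induction l)
    case 0
    show ?case using that(1) by auto
  next
    case (Suc l)
    then obtain v' where v': "norm v' \<le> \<rho> / 2" "v' \<bullet> b = v \<bullet> b" "(g ^^ l) (d 0 v) = d l v'" by auto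
    have "(g ^^ Suc l) (d 0 v) = d (Suc l) ((v \<bullet> b) *\<^sub>R b)"
      using g_core[of l v'] Suc.prems v' by (simp add: nx_def h_def)
    moreover have "norm ((v \<bullet> b) *\<^sub>R b) \<le> \<rho> / 2" using abs_b[of v] that(1) by (simp add: bb)
    ultimately show ?case by (intro exI[of _ "(v \<bullet> b) *\<^sub>R b"]) (simp add: bb)
  qed
  have last: "(g ^^ p) (d 0 v) = d 0 (\<psi> (v \<bullet> b) *\<^sub>R b)" if v: "norm v \<le> \<rho> / 2" for v
  proof -
    obtain l where l: "p = Suc l" using p gr0_implies_Suc by blast
    obtain v' where v': "norm v' \<le> \<rho> / 2" "v' \<bullet> b = v \<bullet> b" "(g ^^ l) (d 0 v) = d l v'"
      using orbit[OF v, of l] l by auto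
    have "(g ^^ p) (d 0 v) = g (d l v')" using v'(3) by (simp add: l)
    also have "\<dots> = d 0 (\<psi> (v \<bullet> b) *\<^sub>R b)"
      using g_core[of l v'] v' by (simp add: l nx_def h_def)
    finally show ?thesis .
  qed
  have fold_ball: "\<psi> t *\<^sub>R b \<in> ball 0 1" for t
    using \<psi>_le[of t] \<rho> by (simp add: bb r_def)
  define Box where "Box = {v :: 'e. \<bar>v \<bullet> b\<bar> \<le> r \<and> norm (v - (v \<bullet> b) *\<^sub>R b) \<le> r}"
  have Box: "norm v \<le> \<rho> / 2" if "v \<in> Box" for v
  proof -
    have "norm v \<le> norm ((v \<bullet> b) *\<^sub>R b) + norm (v - (v \<bullet> b) *\<^sub>R b)"
      using norm_triangle_ineq[of "(v \<bullet> b) *\<^sub>R b" "v - (v \<bullet> b) *\<^sub>R b"] by simp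
    moreover have "norm ((v \<bullet> b) *\<^sub>R b) \<le> r" using that by (simp add: Box_def bb)
    ultimately show ?thesis using that r by (simp add: Box_def r_def)
  qed
  have "\<exists>V W' u \<gamma>. horseshoe g p N V W' u \<gamma>"
  proof (rule chart_horseshoe[OF hom[of 0] W(1) b r r _ p N], unfold Box_def[symmetric])
    show "r + r < 1" using \<rho> by (simp add: r_def)
    fix v assume v: "v \<in> Box"
    have c_last: "c 0 ((g ^^ p) (d 0 v)) = \<psi> (v \<bullet> b) *\<^sub>R b"
      unfolding last[OF Box[OF v]] by (rule cd[OF fold_ball])
    show "(g ^^ p) (d 0 v) \<in> W 0" unfolding last[OF Box[OF v]] by (rule dW[OF fold_ball])
    show "norm (c 0 ((g ^^ p) (d 0 v)) - (c 0 ((g ^^ p) (d 0 v)) \<bullet> b) *\<^sub>R b) < r"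
      unfolding c_last using r by (simp add: bb)
    show "(g ^^ l) (d 0 v) \<notin> d 0 ` Box" if l: "0 < l" "l < p" for l
    proof
      assume "(g ^^ l) (d 0 v) \<in> d 0 ` Box"
      moreover have "d 0 ` Box \<subseteq> V 0"
        unfolding V_def by (intro image_mono subsetI) (use Box \<rho>(1) in fastforce)
      ultimately have 1: "(g ^^ l) (d 0 v) \<in> V 0" by blast
      obtain v' where "norm v' \<le> \<rho> / 2" "(g ^^ l) (d 0 v) = d l v'"
        using orbit[OF Box[OF v] l(2)] by blast
      then have "(g ^^ l) (d 0 v) \<in> V l" using \<rho>(1) by (auto simp: V_def)
      then show False using V_uniq[OF l(2) p _ 1] l(1) by blast
    qed
    have arg: "pi * (v \<bullet> b / (r / N) + N) = pi * j" if "v \<bullet> b = (j - N) * (r / N)" for j :: real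
      using that r N by simp
    show "c 0 ((g ^^ p) (d 0 v)) \<bullet> b < - r" if "i < N" "v \<bullet> b = (2 * real i - N) * (r / N)" for i
    proof -
      have "cos (pi * (2 * real i)) = 1" using cos_npi[of "2 * i"] by (simp add: mult.commute)
      then show ?thesis unfolding c_last \<psi>_def arg[OF that(2)] using r by (simp add: bb)
    qed
    show "r < c 0 ((g ^^ p) (d 0 v)) \<bullet> b" if "i < N" "v \<bullet> b = (2 * real i + 1 - N) * (r / N)" for i
    proof -
      have "cos (pi * (2 * real i + 1)) = - 1" using cos_npi[of "2 * i + 1"] by (simp add: mult.commute add.commute)
      then show ?thesis unfolding c_last \<psi>_def arg[OF that(2)] using r by (simp add: bb)
    qed
  qed
  then have "rich g k" unfolding rich_def using Q N_def by blast
  with g_cont close show ?thesis by blast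
qed

theorem corollaryC:
  fixes A :: "('m::metric_space, 'e::euclidean_space) chart set"
    and G :: "('m, 'e) chart \<Rightarrow> 'e \<Rightarrow> 'e \<Rightarrow> 'e \<Rightarrow> real"
    and S :: "('m \<Rightarrow> 'm) topology"
  assumes "compact (UNIV :: 'm set)"
    and "riemannian_manifold A G"
    and "(S = C0_space \<and> DIM('e) \<ge> 1) \<or> (S = homeo_space \<and> DIM('e) \<ge> 2)"
  shows "\<exists>R. residual_in S R \<and>
    (\<forall>f\<in>R.
      (\<forall>\<theta>. nontrivial_weight \<theta> \<longrightarrow>
         htop f (non_orthogonal \<theta> f) = htop f UNIV \<and> htop f UNIV = \<infinity>) \<and>
      bohr_chaotic f)"
proof -
  note M = assms(1)
  have A: "smooth_atlas A" using assms(2) by (simp add: riemannian_manifold_def)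
  have concl: "(\<forall>\<theta>. nontrivial_weight \<theta> \<longrightarrow>
      htop f (non_orthogonal \<theta> f) = htop f UNIV \<and> htop f UNIV = \<infinity>) \<and> bohr_chaotic f"
    if f: "continuous_on UNIV f" and rich: "\<And>k. rich f k" for f :: "'m \<Rightarrow> 'm"
    using all_rich_htop[OF M f rich] rich_non_orthogonal(2)[OF M f rich]
    by (simp add: bohr_chaotic_def)
  from assms(3) show ?thesis
  proof
    assume S: "S = C0_space \<and> DIM('e) \<ge> 1"
    have C0: "continuous_on UNIV f" if "f \<in> C0_maps" for f :: "'m \<Rightarrow> 'm"
      using that by (simp add: C0_maps_def)
    have "\<exists>g\<in>C0_maps. dist_C0 f g < e \<and> rich g k" if "f \<in> C0_maps" "0 < e" for f :: "'m \<Rightarrow> 'm" and e k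
      using C0_dense_rich[OF M A C0[OF that(1)] that(2), of k] by (auto simp: C0_maps_def)
    then have "residual_in S {f\<in>C0_maps. \<forall>k. rich f k}"
      using S residual_rich[OF M Metric_space_dist_C0[OF M] mcomplete_C0[OF M] C0 order_refl]
      by (simp add: C0_space_def)
    then show ?thesis
      by (intro exI[of _ "{f\<in>C0_maps. \<forall>k. rich f k}"] conjI[OF _ ballI] concl) (auto intro: C0)
  next
    assume S: "S = homeo_space \<and> DIM('e) \<ge> 2"
    have le: "dist_C0 f g \<le> dist_homeo f g" for f g :: "'m \<Rightarrow> 'm" by (simp add: dist_homeo_def)
    have "\<exists>g\<in>homeos. dist_homeo f g < e \<and> rich g k" if "f \<in> homeos" "0 < e" for f :: "'m \<Rightarrow> 'm" and e k
      using homeo_dense_rich[OF M A _ that] S by blast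
    then have "residual_in S {f\<in>homeos. \<forall>k. rich f k}"
      using S residual_rich[OF M Metric_space_dist_homeo[OF M] mcomplete_homeo[OF M] homeosD(1) le]
      by (simp add: homeo_space_def)
    then show ?thesis
      by (intro exI[of _ "{f\<in>homeos. \<forall>k. rich f k}"] conjI[OF _ ballI] concl) (auto intro: homeosD(1))
  qed
qed

end
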